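(* Under assumptions A.1 and A.2 (stated in the context), put $\gamma=\frac{\gamma_1\gamma_2}{\gamma_1+\gamma_2}$ and $\delta=\max\{\frac2\gamma-1,0\}$. There exists a positive constant $C_1$ depending only on $K_1,K_2,\gamma_1$ and $\gamma_2$ of assumption A.2 such that, for any $\tau\in(0,\frac12-\kappa)$ and $\gamma_n=c_1^2n^{2\tau}$, for all sufficiently large $n$, $$\mathbb{P}\{\mathcal{M}_*\subset\widehat{\mathcal{M}}_{\gamma_n}\}\ge \begin{cases} 1-s\exp\big\{-C_1n^{(1-2\kappa)\wedge\frac{(1-2\kappa-2\tau)\gamma}{2}}\big\}, & \text{if } (1-2\kappa)(1+2\delta)<1,\\ 1-s\exp\big\{-C_1n^{\frac{1-\kappa}{1+\delta}\wedge\frac{(1-2\kappa-2\tau)\gamma}{2}}\big\}, & \text{if } (1-2\kappa)(1+2\delta)\ge1, \end{cases}$$ where $a\wedge b=\min\{a,b\}$.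
   Context: Setting. $Y$ is a scalar response and $\mathbf{X}=(X_1,\ldots,X_p)^{\mathrm T}$ a vector of explanatory variables with $\mathbb{E}(X_j)=0$, $\mathbb{E}(X_j^2)=1$; $p$ (and the model) may depend on $n$. Either the linear model $Y=\mathbf{X}^{\mathrm T}\boldsymbol\beta+\varepsilon$ with zero-mean error $\varepsilon$ holds, or a generalized linear model in which $Y$ given $\mathbf X$ has density $\exp\{y\theta-b(\theta)+c(y)\}$ with $\theta=\beta_0+\mathbf{X}^{\mathrm T}\boldsymbol\beta$ (with $Y$ centered to have mean zero). Here $\boldsymbol\beta=(\beta_1,\ldots,\beta_p)^{\mathrm T}$ and $\mathcal{M}_*=\{1\le j\le p:\beta_j\ne0\}$ with $s=|\mathcal{M}_*|$. The data $(\mathbf{X}_i,Y_i)$, $i=1,\ldots,n$, are i.i.d. copies of $(\mathbf X,Y)$, and $X_{ij}$ is the $j$th component of $\mathbf{X}_i$. Marginal empirical likelihood ratio. $\mathrm{EL}_j(0)=\sup\{\prod_{i=1}^nw_i: w_i\ge0,\ \sum_{i=1}^nw_i=1,\ \sum_{i=1}^nw_iX_{ij}Y_i=0\}$ (with $\sup\emptyset=0$) and $\ell_j(0)=-2\log\{\mathrm{EL}_j(0)\}-2n\log n$, with $\ell_j(0)=\infty$ if $0$ is not in the convex hull of $\{X_{ij}Y_i\}_{i=1}^n$ (convention $\log0=-\infty$). For a threshold $\gamma_n$, the selected set is $\widehat{\mathcal{M}}_{\gamma_n}=\{1\le j\le p:\ell_j(0)\ge\gamma_n\}$. A.1: $Y$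 has bounded variance and there exists a positive constant $c_1$ such that $\min_{j\in\mathcal{M}_*}|\mathbb{E}(X_jY)|=\min_{j\in\mathcal{M}_*}|\mathrm{cov}(Y,X_j)|\ge c_1n^{-\kappa}$ for some $\kappa\in[0,\frac12)$. A.2: There are positive constants $K_1,K_2,\gamma_1,\gamma_2$ such that $\mathbb{P}\{|X_j|\ge u\}\le K_1\exp(-K_2u^{\gamma_1})$ for each $j=1,\ldots,p$ and any $u>0$, and $\mathbb{P}\{|Y|\ge u\}\le K_1\exp(-K_2u^{\gamma_2})$ for any $u>0$.
   Formalization: When (1−2κ−2τ)γ/2 ≥ 1−2κ, the constant C_1 may also depend on c_1 of A.1: a constant depending only on K_1, K_2, γ_1, γ_2 is impossible there, since it would have to be at most a multiple of c_1². Otherwise the dependence is as stated. *)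

theory Defs
  imports "HOL-Probability.Probability"
begin

section \<open>Regression model and data\<close>

text \<open>
  Covariates carry indices \<open>1, \<dots>, p\<close>: \<open>X j\<close> is the \<open>j\<close>-th component of the covariate vector
  and \<open>Xs i j\<close> is the \<open>j\<close>-th component of the \<open>i\<close>-th observed covariate vector.
\<close>

definition covariate_space :: "nat \<Rightarrow> (nat \<Rightarrow> real) measure"
  where "covariate_space p = (\<Pi>\<^sub>M j\<in>{1..p}. borel)"

definition covariate_vector :: "nat \<Rightarrow> (nat \<Rightarrow> 'a \<Rightarrow> real) \<Rightarrow> 'a \<Rightarrow> nat \<Rightarrow> real"
  where "covariate_vector p X \<omega> = (\<lambda>j\<in>{1..p}. X j \<omega>)"

definition observation_space :: "nat \<Rightarrow> ((nat \<Rightarrow> real) \<times> real) measure"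
  where "observation_space p = covariate_space p \<Otimes>\<^sub>M borel"

definition observation ::
    "nat \<Rightarrow> (nat \<Rightarrow> 'a \<Rightarrow> real) \<Rightarrow> ('a \<Rightarrow> real) \<Rightarrow> 'a \<Rightarrow> (nat \<Rightarrow> real) \<times> real"
  where "observation p X Y \<omega> = (covariate_vector p X \<omega>, Y \<omega>)"

definition active_set :: "nat \<Rightarrow> (nat \<Rightarrow> real) \<Rightarrow> nat set"
  where "active_set p \<beta> = {j \<in> {1..p}. \<beta> j \<noteq> 0}"

definition linear_model ::
    "'a measure \<Rightarrow> nat \<Rightarrow> (nat \<Rightarrow> 'a \<Rightarrow> real) \<Rightarrow> ('a \<Rightarrow> real) \<Rightarrow> (nat \<Rightarrow> real) \<Rightarrow> bool"
  where
    "linear_model M p X Y \<beta> \<longleftrightarrow>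
       (\<exists>\<epsilon>. integrable M \<epsilon> \<and> prob_space.expectation M \<epsilon> = 0 \<and>
            (AE \<omega> in M. Y \<omega> = (\<Sum>j=1..p. X j \<omega> * \<beta> j) + \<epsilon> \<omega>))"

text \<open>
  \<open>Y\<close> is the centred version of a response \<open>Y'\<close> whose conditional density given the covariates,
  with respect to a \<open>\<sigma>\<close>-finite measure \<open>\<nu>\<close> on the real line (Lebesgue measure, a counting
  measure, \<dots>), has the exponential-family form.  That this function is the conditional density
  is expressed by disintegrating the joint law of the covariates and \<open>Y'\<close> over the law of the
  covariates.
\<close>

definition generalized_linear_model ::
    "'a measure \<Rightarrow> nat \<Rightarrow> (nat \<Rightarrow> 'a \<Rightarrow> real) \<Rightarrow> ('a \<Rightarrow> real) \<Rightarrow> (nat \<Rightarrow> real) \<Rightarrow> bool"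
  where
    "generalized_linear_model M p X Y \<beta> \<longleftrightarrow>
       (\<exists>(Y' :: 'a \<Rightarrow> real) (\<nu> :: real measure) (b :: real \<Rightarrow> real) (c :: real \<Rightarrow> real) (\<beta>0 :: real).
          integrable M Y' \<and>
          (AE \<omega> in M. Y \<omega> = Y' \<omega> - prob_space.expectation M Y') \<and>
          sigma_finite_measure \<nu> \<and> sets \<nu> = sets borel \<and>
          b \<in> borel_measurable borel \<and> c \<in> borel_measurable borel \<and>
          distr M (observation_space p) (observation p X Y') =
            density (distr M (covariate_space p) (covariate_vector p X) \<Otimes>\<^sub>M \<nu>)
              (\<lambda>(x, y). let \<theta> = \<beta>0 + (\<Sum>j=1..p. x j * \<beta> j)
                        in ennreal (exp (y * \<theta> - b \<theta> + c y))))"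

definition iid_copies ::
    "'a measure \<Rightarrow> nat \<Rightarrow> nat \<Rightarrow> (nat \<Rightarrow> 'a \<Rightarrow> real) \<Rightarrow> ('a \<Rightarrow> real) \<Rightarrow>
     (nat \<Rightarrow> nat \<Rightarrow> 'a \<Rightarrow> real) \<Rightarrow> (nat \<Rightarrow> 'a \<Rightarrow> real) \<Rightarrow> bool"
  where
    "iid_copies M n p X Y Xs Ys \<longleftrightarrow>
       prob_space.indep_vars M (\<lambda>_. observation_space p) (\<lambda>i. observation p (Xs i) (Ys i)) {1..n} \<and>
       (\<forall>i\<in>{1..n}. distr M (observation_space p) (observation p (Xs i) (Ys i)) =
                   distr M (observation_space p) (observation p X Y))"

definition regression_setting ::
    "'a measure \<Rightarrow> nat \<Rightarrow> nat \<Rightarrow> (nat \<Rightarrow> 'a \<Rightarrow> real) \<Rightarrow> ('a \<Rightarrow> real) \<Rightarrow> (nat \<Rightarrow> real) \<Rightarrow>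
     (nat \<Rightarrow> nat \<Rightarrow> 'a \<Rightarrow> real) \<Rightarrow> (nat \<Rightarrow> 'a \<Rightarrow> real) \<Rightarrow> bool"
  where
    "regression_setting M n p X Y \<beta> Xs Ys \<longleftrightarrow>
       prob_space M \<and>
       observation p X Y \<in> M \<rightarrow>\<^sub>M observation_space p \<and>
       (\<forall>j\<in>{1..p}. integrable M (\<lambda>\<omega>. (X j \<omega>)\<^sup>2) \<and>
                   prob_space.expectation M (X j) = 0 \<and>
                   prob_space.expectation M (\<lambda>\<omega>. (X j \<omega>)\<^sup>2) = 1) \<and>
       (linear_model M p X Y \<beta> \<or> generalized_linear_model M p X Y \<beta>) \<and>
       iid_copies M n p X Y Xs Ys"


section \<open>Marginal empirical likelihood\<close>

definition EL_values :: "nat \<Rightarrow> (nat \<Rightarrow> real) \<Rightarrow> real set"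
  where
    "EL_values n z =
       {\<Prod>i=1..n. w i | w. (\<forall>i\<in>{1..n}. 0 \<le> w i) \<and> (\<Sum>i=1..n. w i) = 1 \<and>
                         (\<Sum>i=1..n. w i * z i) = 0}"

text \<open>The case distinction fixes the supremum of the empty set, which is unspecified on the reals.\<close>

definition EL :: "nat \<Rightarrow> (nat \<Rightarrow> real) \<Rightarrow> real"
  where "EL n z = (if EL_values n z = {} then 0 else Sup (EL_values n z))"

text \<open>Logarithm on the nonnegative reals with value \<open>-\<infinity>\<close> at zero.\<close>

definition extended_ln :: "real \<Rightarrow> ereal"
  where "extended_ln x = (if x = 0 then -\<infinity> else ereal (ln x))"

definition EL_ratio :: "nat \<Rightarrow> (nat \<Rightarrow> real) \<Rightarrow> ereal"
  where "EL_ratio n z = - 2 * extended_ln (EL n z) - ereal (2 * real n * ln (real n))"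

text \<open>The stipulated value \<open>\<infinity>\<close> outside the convex hull is already what the formula gives.\<close>

lemma EL_ratio_outside_hull:
  assumes "0 \<notin> convex hull (z ` {1..n})"
  shows "EL_ratio n z = \<infinity>"
proof -
  have "EL_values n z = {}"
  proof (rule ccontr)
    assume "EL_values n z \<noteq> {}"
    then obtain w where w: "\<forall>i\<in>{1..n}. 0 \<le> w i" "(\<Sum>i=1..n. w i) = 1" "(\<Sum>i=1..n. w i * z i) = 0"
      unfolding EL_values_def by blast
    have "(\<Sum>i=1..n. w i *\<^sub>R z i) \<in> convex hull (z ` {1..n})"
      by (rule convex_sum) (use w in \<open>auto simp: hull_inc\<close>)
    with w(3) assms show False by simp
  qed
  then show ?thesis
    by (simp add: EL_ratio_def EL_def extended_ln_def)
qed

definition selected_set ::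
    "nat \<Rightarrow> nat \<Rightarrow> (nat \<Rightarrow> nat \<Rightarrow> 'a \<Rightarrow> real) \<Rightarrow> (nat \<Rightarrow> 'a \<Rightarrow> real) \<Rightarrow> real \<Rightarrow> 'a \<Rightarrow> nat set"
  where
    "selected_set n p Xs Ys t \<omega> =
       {j \<in> {1..p}. EL_ratio n (\<lambda>i. Xs i j \<omega> * Ys i \<omega>) \<ge> ereal t}"


section \<open>Assumptions on a sequence of models\<close>

text \<open>
  The sample size indexes the sequence, so the probability space, the number of covariates and the
  distribution may all change with it, while the constants may not.
\<close>

definition assumption_A1 ::
    "(nat \<Rightarrow> 'a measure) \<Rightarrow> (nat \<Rightarrow> nat) \<Rightarrow> (nat \<Rightarrow> nat \<Rightarrow> 'a \<Rightarrow> real) \<Rightarrow> (nat \<Rightarrow> 'a \<Rightarrow> real) \<Rightarrow>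
     (nat \<Rightarrow> nat \<Rightarrow> real) \<Rightarrow> real \<Rightarrow> real \<Rightarrow> bool"
  where
    "assumption_A1 M p X Y \<beta> c1 \<kappa> \<longleftrightarrow>
       0 < c1 \<and> 0 \<le> \<kappa> \<and> \<kappa> < 1/2 \<and>
       (\<exists>V. \<forall>n\<ge>1. integrable (M n) (\<lambda>\<omega>. (Y n \<omega>)\<^sup>2) \<and> prob_space.variance (M n) (Y n) \<le> V) \<and>
       (\<forall>n\<ge>1. \<forall>j\<in>active_set (p n) (\<beta> n).
          \<bar>prob_space.expectation (M n) (\<lambda>\<omega>. X n j \<omega> * Y n \<omega>)\<bar> \<ge> c1 * real n powr (- \<kappa>))"

definition assumption_A2 ::
    "(nat \<Rightarrow> 'a measure) \<Rightarrow> (nat \<Rightarrow> nat) \<Rightarrow> (nat \<Rightarrow> nat \<Rightarrow> 'a \<Rightarrow> real) \<Rightarrow> (nat \<Rightarrow> 'a \<Rightarrow> real) \<Rightarrow>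
     real \<Rightarrow> real \<Rightarrow> real \<Rightarrow> real \<Rightarrow> bool"
  where
    "assumption_A2 M p X Y K1 K2 \<gamma>1 \<gamma>2 \<longleftrightarrow>
       0 < K1 \<and> 0 < K2 \<and> 0 < \<gamma>1 \<and> 0 < \<gamma>2 \<and>
       (\<forall>n\<ge>1. \<forall>u>0.
          (\<forall>j\<in>{1..p n}. measure (M n) {\<omega> \<in> space (M n). \<bar>X n j \<omega>\<bar> \<ge> u} \<le> K1 * exp (- K2 * u powr \<gamma>1)) \<and>
          measure (M n) {\<omega> \<in> space (M n). \<bar>Y n \<omega>\<bar> \<ge> u} \<le> K1 * exp (- K2 * u powr \<gamma>2))"

text \<open>
  The constant in the exponent of the screening bound can be chosen from \<open>K1, K2, \<gamma>1, \<gamma>2\<close> alone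
  when \<open>(1 - 2\<kappa> - 2\<tau>)\<gamma>/2 < 1 - 2\<kappa>\<close>, in particular whenever \<open>\<gamma> \<le> 2\<close>.  Otherwise the exponent of \<open>n\<close>
  is \<open>1 - 2\<kappa>\<close>, the Gaussian rate \<open>n E(X\<^sub>j Y)\<^sup>2\<close> for a signal of size \<open>c1 n powr (-\<kappa>)\<close>, and the
  constant cannot exceed a multiple of \<open>c1\<^sup>2\<close>.  For this range only, the theorem uses a
  second constant that may also depend on \<open>c1\<close>.
\<close>

end

theory Submission
  imports Defs "HOL-Real_Asymp.Real_Asymp"
begin

text \<open>
  A covariate is missed only if the marginal empirical likelihood ratio of the products
  \<open>z\<^sub>i = X\<^sub>i\<^sub>j Y\<^sub>i\<close> stays below \<open>c1\<^sup>2 n\<^bsup>2\<tau>\<^esup>\<close>.  By weak duality the ratio is at least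
  \<open>2 \<theta> \<Sum> z\<^sub>i - 4 \<theta>\<^sup>2 \<Sum> z\<^sub>i\<^sup>2\<close> for every \<open>\<theta>\<close> with \<open>|\<theta> z\<^sub>i| \<le> 1/2\<close>
  (\<open>EL_ratio_dual_bound\<close>).  Put \<open>a = 1/2 - \<kappa> - \<tau>\<close>.  If all \<open>|z\<^sub>i|\<close> are at most \<open>n\<^sup>a / 4\<close> and the
  sum is at least half of its mean, whose size is at least \<open>c1 n\<^bsup>1-\<kappa>\<^esup>\<close>, then \<open>\<theta>\<close> of order
  \<open>n\<^bsup>\<kappa>+2\<tau>-1\<^esup>\<close> makes this bound reach the threshold, with the trivial estimate \<open>n (n\<^sup>a / 4)\<^sup>2\<close>
  for the sum of squares (\<open>dual_multiplier_gain\<close>).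

  Two events remain.  The products have tails \<open>exp (- K2 u\<^sup>\<gamma>)\<close> (\<open>subweibull_product\<close>), so an
  observation above \<open>n\<^sup>a / 4\<close> has probability at most \<open>exp (- C1 n\<^bsup>a\<gamma>\<^esup>)\<close> up to lower order, with a
  constant \<open>C1\<close> that depends on \<open>K2\<close> and \<open>\<gamma>\<close> only.  A sum of bounded observations below half of
  its mean is controlled by a Chernoff bound (\<open>truncated_chernoff\<close>, \<open>truncated_mgf_bound\<close>) whose
  parameter is limited both by the signal and, for \<open>\<gamma> < 1\<close>, by the truncation level; its exponent is
  \<open>min (1 - 2\<kappa>) (1/2 + \<tau> + a\<gamma>)\<close>.  If \<open>a\<gamma> < 1 - 2\<kappa>\<close>, this exponent exceeds \<open>a\<gamma>\<close> and the second
  event is of lower order; otherwise it equals \<open>1 - 2\<kappa>\<close> and the constant, which involves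
  \<open>c1\<close>, enters the final bound.  Either way the exponent is \<open>min (1 - 2\<kappa>) (a\<gamma>)\<close>, and both regimes of
  the theorem reduce to it (\<open>screening_exponent_eq\<close>).  All thresholds for \<open>n\<close> are uniform over the
  active covariates, so a union bound finishes the proof; it needs the selection events
  to be measurable, which is a compactness argument (\<open>measurable_EL_ratio_ge\<close>).
\<close>

section \<open>Duality for the empirical likelihood ratio\<close>

lemma EL_values_bounds:
  assumes "v \<in> EL_values n z"
  shows "0 \<le> v" "v \<le> 1"
proof -
  obtain w where w: "v = (\<Prod>i=1..n. w i)" "\<forall>i\<in>{1..n}. 0 \<le> w i" "(\<Sum>i=1..n. w i) = 1"
    using assms by (auto simp: EL_values_def)
  show "0 \<le> v" unfolding w(1) using w(2) by (intro prod_nonneg) blast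
  have "w i \<le> 1" if "i \<in> {1..n}" for i
    using member_le_sum[of i "{1..n}" w] w that by auto
  then show "v \<le> 1" using w by (auto intro: prod_le_1)
qed

lemma EL_le_iff:
  assumes "0 \<le> c"
  shows "EL n z \<le> c \<longleftrightarrow> (\<forall>v\<in>EL_values n z. v \<le> c)"
proof (cases "EL_values n z = {}")
  case False
  have "bdd_above (EL_values n z)"
    using EL_values_bounds(2) by (rule bdd_aboveI)
  with False show ?thesis by (simp add: EL_def cSup_le_iff)
qed (use assms in \<open>simp add: EL_def\<close>)

lemma EL_nonneg: "0 \<le> EL n z"
proof (cases "EL_values n z = {}")
  case False
  then obtain v where v: "v \<in> EL_values n z" by auto
  have "bdd_above (EL_values n z)"
    using EL_values_bounds(2) by (rule bdd_aboveI)
  with v have "v \<le> EL n z" by (auto simp: EL_def intro: cSup_upper)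
  with EL_values_bounds(1)[OF v] show ?thesis by linarith
qed (simp add: EL_def)

text \<open>
  Both the lower bound and the measurability argument work with the feasible weights themselves:
  this form removes the supremum, the logarithm and the infinite values.
\<close>

lemma EL_ratio_ge_iff:
  assumes "1 \<le> n"
  shows "ereal t \<le> EL_ratio n z \<longleftrightarrow>
    (\<forall>v\<in>EL_values n z. v \<le> exp (- t / 2) / real n ^ n)"
proof -
  have "ereal t \<le> EL_ratio n z \<longleftrightarrow> EL n z \<le> exp (- t / 2) / real n ^ n"
  proof (cases "EL n z = 0")
    case True
    then show ?thesis by (simp add: EL_ratio_def extended_ln_def)
  next
    case False
    with EL_nonneg[of n z] have pos: "0 < EL n z" by linarith
    have "ereal t \<le> EL_ratio n z \<longleftrightarrow> t \<le> - 2 * ln (EL n z) - 2 * real n * ln (real n)"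
      using False by (simp add: EL_ratio_def extended_ln_def)
    also have "\<dots> \<longleftrightarrow> ln (EL n z) \<le> ln (exp (- t / 2) / real n ^ n)"
      using assms by (auto simp: ln_div ln_realpow field_simps)
    also have "\<dots> \<longleftrightarrow> EL n z \<le> exp (- t / 2) / real n ^ n"
      using assms pos by (intro ln_le_cancel_iff) auto
    finally show ?thesis .
  qed
  then show ?thesis using assms by (simp add: EL_le_iff)
qed

lemma prod_le_1_of_sum_le_card:
  fixes u :: "'b \<Rightarrow> real"
  assumes "\<And>i. i \<in> I \<Longrightarrow> 0 \<le> u i" "(\<Sum>i\<in>I. u i) \<le> real (card I)"
  shows "(\<Prod>i\<in>I. u i) \<le> 1"
proof (cases "finite I")
  case True
  have "(\<Prod>i\<in>I. u i) \<le> (\<Prod>i\<in>I. exp (u i - 1))"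
    using assms(1) exp_ge_add_one_self[of "u i - 1" for i] by (intro prod_mono) auto
  also have "\<dots> = exp ((\<Sum>i\<in>I. u i) - real (card I))"
    using True by (simp flip: exp_sum add: sum_subtractf)
  also have "\<dots> \<le> 1" using assms(2) by simp
  finally show ?thesis .
qed simp

text \<open>
  Weak duality: a feasible \<open>w\<close> satisfies \<open>\<Sum> w\<^sub>i (1 + \<theta> z\<^sub>i) = 1\<close> for every multiplier
  \<open>\<theta>\<close>, so the product of the \<open>n w\<^sub>i (1 + \<theta> z\<^sub>i)\<close> is at most \<open>1\<close>.  Hence the ratio is at least
  \<open>2 \<Sum> ln (1 + \<theta> z\<^sub>i)\<close>, and the stated bound is its quadratic approximation.  The multiplier is
  free, so that later it can be taken deterministic.
\<close>

lemma EL_ratio_dual_bound: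
  assumes n: "1 \<le> n"
    and small: "\<And>i. i \<in> {1..n} \<Longrightarrow> \<bar>\<theta> * z i\<bar> \<le> 1/2"
    and t: "t \<le> 2 * (\<theta> * (\<Sum>i=1..n. z i) - 2 * \<theta>\<^sup>2 * (\<Sum>i=1..n. (z i)\<^sup>2))"
  shows "ereal t \<le> EL_ratio n z"
  unfolding EL_ratio_ge_iff[OF n]
proof
  fix v assume "v \<in> EL_values n z"
  then obtain w where w: "v = (\<Prod>i=1..n. w i)" "\<forall>i\<in>{1..n}. 0 \<le> w i" "(\<Sum>i=1..n. w i) = 1"
      "(\<Sum>i=1..n. w i * z i) = 0"
    by (auto simp: EL_values_def)
  have pos: "0 < 1 + \<theta> * z i" if "i \<in> {1..n}" for i
    using small[OF that] by linarith
  have "(\<Sum>i=1..n. real n * w i * (1 + \<theta> * z i)) =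
      real n * (\<Sum>i=1..n. w i) + real n * \<theta> * (\<Sum>i=1..n. w i * z i)"
    by (simp add: sum_distrib_left sum.distrib[symmetric] algebra_simps)
  also have "\<dots> = real (card {1..n})" using w by simp
  finally have "(\<Prod>i=1..n. real n * w i * (1 + \<theta> * z i)) \<le> 1"
    using w(2) pos by (intro prod_le_1_of_sum_le_card mult_nonneg_nonneg) (auto intro: less_imp_le)
  then have prod1: "real n ^ n * v * (\<Prod>i=1..n. 1 + \<theta> * z i) \<le> 1"
    by (simp add: prod.distrib w)
  have "exp (t / 2) \<le> exp (\<Sum>i=1..n. \<theta> * z i - 2 * (\<theta> * z i)\<^sup>2)"
  proof -
    have "(\<Sum>i=1..n. \<theta> * z i - 2 * (\<theta> * z i)\<^sup>2) =
        \<theta> * (\<Sum>i=1..n. z i) - 2 * \<theta>\<^sup>2 * (\<Sum>i=1..n. (z i)\<^sup>2)"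
      by (simp add: sum_subtractf sum_distrib_left power_mult_distrib mult.assoc)
    with t show ?thesis by simp
  qed
  also have "\<dots> = (\<Prod>i=1..n. exp (\<theta> * z i - 2 * (\<theta> * z i)\<^sup>2))"
    by (simp add: exp_sum)
  also have "\<dots> \<le> (\<Prod>i=1..n. 1 + \<theta> * z i)"
  proof (intro prod_mono conjI)
    fix i assume i: "i \<in> {1..n}"
    have "\<theta> * z i - 2 * (\<theta> * z i)\<^sup>2 \<le> ln (1 + \<theta> * z i)"
      using abs_ln_one_plus_x_minus_x_bound[OF small[OF i]] by linarith
    then show "exp (\<theta> * z i - 2 * (\<theta> * z i)\<^sup>2) \<le> 1 + \<theta> * z i"
      using pos[OF i] by (simp add: ln_ge_iff)
  qed simp
  finally have "real n ^ n * v * exp (t / 2) \<le> real n ^ n * v * (\<Prod>i=1..n. 1 + \<theta> * z i)"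
    using w by (intro mult_left_mono) (auto intro!: mult_nonneg_nonneg prod_nonneg)
  with prod1 have "real n ^ n * v * exp (t / 2) \<le> 1" by linarith
  then show "v \<le> exp (- t / 2) / real n ^ n"
    using n by (simp add: field_simps exp_minus)
qed

section \<open>Measurability of the selection events\<close>

lemma closed_projection_along_compact:
  fixes S :: "'b::topological_space set" and T :: "('b \<times> 'c::topological_space) set"
  assumes "compact S" "closed T"
  shows "closed {y. \<exists>x\<in>S. (x, y) \<in> T}"
proof -
  have "closed_map (prod_topology (top_of_set S) euclidean) (euclidean :: 'c topology) snd"
    using assms(1) by (intro Abstract_Topological_Spaces.closed_map_snd) (simp add: compact_space_subtopology)
  then have "closed_map (top_of_set (S \<times> (UNIV :: 'c set))) (euclidean :: 'c topology) snd"
    by (metis prod_topology_subtopology_eu subtopology_UNIV)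
  moreover have "closedin (top_of_set (S \<times> UNIV)) ((S \<times> UNIV) \<inter> T)"
    using assms(2) by (rule closedin_closed_Int)
  ultimately have "closed (snd ` ((S \<times> UNIV) \<inter> T))"
    by (simp add: closed_map_def)
  moreover have "snd ` ((S \<times> UNIV) \<inter> T) = {y. \<exists>x\<in>S. (x, y) \<in> T}"
    by force
  ultimately show ?thesis by simp
qed

text \<open>
  The feasible weights range over a compact set, and the moment constraint and the product are
  jointly continuous in weights and data, so this set is the projection of a closed set along a
  compact factor.
\<close>

lemma closed_EL_values_ge:
  "closed {z. \<exists>v\<in>EL_values n z. c \<le> v}"
proof -
  define S :: "(nat \<Rightarrow> real) set" where "S = Pi\<^sub>E UNIV (\<lambda>i. if i \<in> {1..n} then {0..1} else {0})"
  define T :: "((nat \<Rightarrow> real) \<times> (nat \<Rightarrow> real)) set" where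
    "T = {p. (\<Sum>i=1..n. fst p i) = 1} \<inter> {p. (\<Sum>i=1..n. fst p i * snd p i) = 0}
       \<inter> {p. c \<le> (\<Prod>i=1..n. fst p i)}"
  have "compactin (product_topology (\<lambda>i::nat. euclidean :: real topology) UNIV) S"
    unfolding S_def by (auto simp: compactin_PiE)
  then have S: "compact S"
    by (simp add: euclidean_product_topology)
  have c1: "continuous_on UNIV (\<lambda>p :: (nat \<Rightarrow> real) \<times> (nat \<Rightarrow> real). fst p i)" for i
    by (rule continuous_on_product_then_coordinatewise) (intro continuous_intros)
  have c2: "continuous_on UNIV (\<lambda>p :: (nat \<Rightarrow> real) \<times> (nat \<Rightarrow> real). snd p i)" for i
    by (rule continuous_on_product_then_coordinatewise) (intro continuous_intros)
  have T: "closed T"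
    unfolding T_def
    by (intro closed_Int closed_Collect_eq closed_Collect_le continuous_intros c1 c2)
  have "(\<exists>v\<in>EL_values n z. c \<le> v) \<longleftrightarrow> (\<exists>w\<in>S. (w, z) \<in> T)" for z
  proof
    assume "\<exists>v\<in>EL_values n z. c \<le> v"
    then obtain w where w: "c \<le> (\<Prod>i=1..n. w i)" "\<forall>i\<in>{1..n}. 0 \<le> w i" "(\<Sum>i=1..n. w i) = 1"
        "(\<Sum>i=1..n. w i * z i) = 0"
      by (auto simp: EL_values_def)
    have "w i \<le> 1" if "i \<in> {1..n}" for i
      using member_le_sum[of i "{1..n}" w] w that by auto
    then have "(\<lambda>i. if i \<in> {1..n} then w i else 0) \<in> S"
      using w by (auto simp: S_def)
    moreover have "((\<lambda>i. if i \<in> {1..n} then w i else 0), z) \<in> T"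
    proof -
      let ?w = "\<lambda>i. if i \<in> {1..n} then w i else 0"
      have "(\<Sum>i=1..n. ?w i) = (\<Sum>i=1..n. w i)" "(\<Sum>i=1..n. ?w i * z i) = (\<Sum>i=1..n. w i * z i)"
          "(\<Prod>i=1..n. ?w i) = (\<Prod>i=1..n. w i)"
        by (auto intro!: sum.cong prod.cong)
      then show ?thesis unfolding T_def using w by (simp only: Int_iff mem_Collect_eq fst_conv snd_conv simp_thms)
    qed
    ultimately show "\<exists>w\<in>S. (w, z) \<in> T" by blast
  next
    assume "\<exists>w\<in>S. (w, z) \<in> T"
    then obtain w where "w \<in> S" "(w, z) \<in> T" by blast
    moreover from \<open>w \<in> S\<close> have "\<forall>i\<in>{1..n}. 0 \<le> w i"
      by (auto simp: S_def PiE_iff split: if_splits)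
    ultimately have "(\<Prod>i=1..n. w i) \<in> EL_values n z" "c \<le> (\<Prod>i=1..n. w i)"
      by (auto simp: T_def EL_values_def)
    then show "\<exists>v\<in>EL_values n z. c \<le> v" by blast
  qed
  then show ?thesis
    using closed_projection_along_compact[OF S T] by simp
qed

text \<open>
  The equality constraint on the weights prevents a reduction to countably many weights.  Instead,
  the complement of the event is a countable union of preimages of the closed sets above; the union
  over \<open>k\<close> passes from \<open>\<ge>\<close> to the strict inequality.
\<close>

lemma measurable_EL_ratio_ge:
  assumes n: "1 \<le> n" and Z: "\<And>i. i \<in> {1..n} \<Longrightarrow> Z i \<in> borel_measurable M"
  shows "{\<omega> \<in> space M. ereal t \<le> EL_ratio n (\<lambda>i. Z i \<omega>)} \<in> sets M"
proof -
  define c where "c = exp (- t / 2) / real n ^ n"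
  \<comment> \<open>Closed sets live in the space of all sequences, so the data are extended by zero.\<close>
  define Z' where "Z' \<omega> = (\<lambda>i. if i \<in> {1..n} then Z i \<omega> else 0)" for \<omega>
  have Z': "Z' \<in> M \<rightarrow>\<^sub>M borel"
    unfolding Z'_def
  proof (rule measurable_coordinatewise_then_product)
    show "(\<lambda>\<omega>. if i \<in> {1..n} then Z i \<omega> else 0) \<in> borel_measurable M" for i
      using Z by (cases "i \<in> {1..n}") auto
  qed
  have vals: "EL_values n (\<lambda>i. Z i \<omega>) = EL_values n (Z' \<omega>)" for \<omega>
  proof -
    have "(\<Sum>i=1..n. w i * Z' \<omega> i) = (\<Sum>i=1..n. w i * Z i \<omega>)" for w :: "nat \<Rightarrow> real"
      by (intro sum.cong) (auto simp: Z'_def)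
    then show ?thesis by (simp add: EL_values_def)
  qed
  define B where "B k = {z. \<exists>v\<in>EL_values n z. c + 1 / real (Suc k) \<le> v}" for k
  have B: "B k \<in> sets borel" for k
    unfolding B_def by (intro borel_closed closed_EL_values_ge)
  have "(\<exists>v\<in>EL_values n z. c < v) \<longleftrightarrow> (\<exists>k. z \<in> B k)" for z
  proof
    assume "\<exists>v\<in>EL_values n z. c < v"
    then obtain v where v: "v \<in> EL_values n z" "c < v" by blast
    from v(2) obtain k where "1 / real (Suc k) < v - c"
      using nat_approx_posE[of "v - c"] by auto
    with v(1) have "z \<in> B k" by (auto simp: B_def intro!: bexI[of _ v])
    then show "\<exists>k. z \<in> B k" ..
  next
    assume "\<exists>k. z \<in> B k"
    then obtain k v where "v \<in> EL_values n z" "c + 1 / real (Suc k) \<le> v"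
      by (auto simp: B_def)
    moreover have "0 < 1 / real (Suc k)" by simp
    ultimately show "\<exists>v\<in>EL_values n z. c < v"
      by (intro bexI[of _ v]) linarith+
  qed
  then have "ereal t \<le> EL_ratio n (\<lambda>i. Z i \<omega>) \<longleftrightarrow> (\<forall>k. Z' \<omega> \<notin> B k)" for \<omega>
    unfolding EL_ratio_ge_iff[OF n] vals c_def[symmetric] by (meson not_le)
  then have "{\<omega> \<in> space M. ereal t \<le> EL_ratio n (\<lambda>i. Z i \<omega>)} = space M - (\<Union>k. Z' -` B k \<inter> space M)"
    by auto
  also have "\<dots> \<in> sets M"
    using measurable_sets[OF Z' B] by (intro sets.Diff sets.top sets.countable_nat_UN) auto
  finally show ?thesis .
qed

section \<open>Sub-Weibull tails and truncated exponential moments\<close>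

lemma exp_le_quadratic_remainder:
  fixes x :: real
  shows "exp x \<le> 1 + x + x\<^sup>2 * exp \<bar>x\<bar>"
proof -
  obtain t where t: "\<bar>t\<bar> \<le> \<bar>x\<bar>" "exp x = (\<Sum>m<2. x ^ m / fact m) + exp t / fact 2 * x ^ 2"
    using Maclaurin_exp_le[of x 2] by blast
  have "exp t / 2 * x\<^sup>2 \<le> exp \<bar>x\<bar> * x\<^sup>2"
  proof (rule mult_right_mono)
    have "exp t \<le> exp \<bar>x\<bar>" using t(1) by simp
    then show "exp t / 2 \<le> exp \<bar>x\<bar>" using exp_gt_zero[of t] by linarith
  qed simp
  with t(2) show ?thesis by (simp add: numeral_2_eq_2 algebra_simps)
qed

lemma powr_le_exp:
  fixes x a b :: real
  assumes "0 \<le> x" "0 < a" "0 < b"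
  shows "x powr a \<le> (a / b) powr a * exp (b * x)"
proof -
  have "x = a / b * (b * x / a)" using assms by simp
  also have "\<dots> \<le> a / b * exp (b * x / a)"
  proof (rule mult_left_mono)
    show "b * x / a \<le> exp (b * x / a)"
      using exp_ge_add_one_self[of "b * x / a"] by linarith
  qed (use assms in simp)
  finally have "x powr a \<le> (a / b * exp (b * x / a)) powr a"
    using assms by (intro powr_mono2) auto
  also have "\<dots> = (a / b) powr a * exp (b * x)"
    unfolding powr_mult exp_powr_real using assms by simp
  finally show ?thesis .
qed

text \<open>
  Splitting according to the integer part of \<open>V\<close> leaves a geometric series; the factor \<open>3/4\<close> is any
  number below the tail rate \<open>1\<close>.
\<close>

lemma (in prob_space) exp_tail_imp_exp_moment:
  fixes V :: "'a \<Rightarrow> real"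
  assumes V [measurable]: "V \<in> borel_measurable M" and nonneg: "\<And>\<omega>. 0 \<le> V \<omega>" and K: "0 \<le> K"
    and tail: "\<And>k::nat. prob {\<omega> \<in> space M. real k \<le> V \<omega>} \<le> K * exp (- real k)"
  shows "(\<integral>\<^sup>+\<omega>. ennreal (exp (3/4 * V \<omega>)) \<partial>M) \<le> ennreal (K * exp (3/4) / (1 - exp (-1/4)))"
proof -
  define a where "a k = exp (3/4 * (real k + 1))" for k :: nat
  have pointwise: "ennreal (exp (3/4 * V \<omega>)) \<le>
      (\<Sum>k. ennreal (a k) * indicator {\<omega> \<in> space M. real k \<le> V \<omega>} \<omega>)" if "\<omega> \<in> space M" for \<omega>
  proof -
    define k where "k = nat \<lfloor>V \<omega>\<rfloor>"
    have k: "real k \<le> V \<omega>" "V \<omega> \<le> real k + 1"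
      using nonneg[of \<omega>] unfolding k_def by (simp, linarith)
    have "ennreal (exp (3/4 * V \<omega>)) \<le> ennreal (a k) * indicator {\<omega> \<in> space M. real k \<le> V \<omega>} \<omega>"
      using k that by (auto simp: a_def intro!: ennreal_leI)
    also have "\<dots> \<le> (\<Sum>k. ennreal (a k) * indicator {\<omega> \<in> space M. real k \<le> V \<omega>} \<omega>)"
      using sum_le_suminf[OF summableI, of "{k}" "\<lambda>k. ennreal (a k) * indicator {\<omega> \<in> space M. real k \<le> V \<omega>} \<omega>"]
      by (simp del: sum_mult_indicator)
    finally show ?thesis .
  qed
  have "(\<integral>\<^sup>+\<omega>. ennreal (exp (3/4 * V \<omega>)) \<partial>M) \<le>
      (\<integral>\<^sup>+\<omega>. (\<Sum>k. ennreal (a k) * indicator {\<omega> \<in> space M. real k \<le> V \<omega>} \<omega>) \<partial>M)"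
    by (intro nn_integral_mono pointwise)
  also have "\<dots> = (\<Sum>k. ennreal (a k) * emeasure M {\<omega> \<in> space M. real k \<le> V \<omega>})"
    by (subst nn_integral_suminf) (auto simp: nn_integral_cmult_indicator)
  also have "\<dots> \<le> (\<Sum>k. ennreal (K * exp (3/4) * exp (-1/4) ^ k))"
  proof (intro suminf_le allI summableI)
    fix k :: nat
    have "ennreal (a k) * emeasure M {\<omega> \<in> space M. real k \<le> V \<omega>} =
        ennreal (a k * prob {\<omega> \<in> space M. real k \<le> V \<omega>})"
      by (simp add: emeasure_eq_measure ennreal_mult a_def)
    also have "\<dots> \<le> ennreal (a k * (K * exp (- real k)))"
      using tail[of k] by (intro ennreal_leI mult_left_mono) (auto simp: a_def)
    also have "a k * (K * exp (- real k)) = K * exp (3/4) * exp (-1/4) ^ k"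
      by (simp add: a_def exp_of_nat_mult[symmetric] exp_add[symmetric] algebra_simps)
    finally show "ennreal (a k) * emeasure M {\<omega> \<in> space M. real k \<le> V \<omega>} \<le> \<dots>" .
  qed
  also have "\<dots> = ennreal (K * exp (3/4) / (1 - exp (-1/4)))"
    using sums_mult[OF geometric_sums[of "exp (-1/4) :: real"], of "K * exp (3/4)"] K
    by (intro suminf_ennreal_eq) auto
  finally show ?thesis .
qed

text \<open>
  The threshold \<open>u\<close> is split as a product of two powers chosen so that both tails decay at the
  same rate, which is where the harmonic combination of \<open>\<gamma>1\<close> and \<open>\<gamma>2\<close> comes from.
\<close>

lemma (in prob_space) subweibull_product:
  fixes X Y :: "'a \<Rightarrow> real"
  assumes [measurable]: "X \<in> borel_measurable M" "Y \<in> borel_measurable M"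
    and pos: "0 < \<gamma>1" "0 < \<gamma>2" and u: "0 < u"
    and X: "\<And>u. 0 < u \<Longrightarrow> prob {\<omega> \<in> space M. u \<le> \<bar>X \<omega>\<bar>} \<le> K1 * exp (- K2 * u powr \<gamma>1)"
    and Y: "\<And>u. 0 < u \<Longrightarrow> prob {\<omega> \<in> space M. u \<le> \<bar>Y \<omega>\<bar>} \<le> K1 * exp (- K2 * u powr \<gamma>2)"
  shows "prob {\<omega> \<in> space M. u \<le> \<bar>X \<omega> * Y \<omega>\<bar>} \<le>
    2 * K1 * exp (- K2 * u powr (\<gamma>1 * \<gamma>2 / (\<gamma>1 + \<gamma>2)))"
proof -
  define a where "a = u powr (\<gamma>2 / (\<gamma>1 + \<gamma>2))"
  define b where "b = u powr (\<gamma>1 / (\<gamma>1 + \<gamma>2))"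
  have ab: "0 < a" "0 < b" using u by (auto simp: a_def b_def)
  have "a * b = u"
  proof -
    have "\<gamma>2 / (\<gamma>1 + \<gamma>2) + \<gamma>1 / (\<gamma>1 + \<gamma>2) = 1"
      using pos by (simp flip: add_divide_distrib)
    then show ?thesis using u by (simp add: a_def b_def flip: powr_add)
  qed
  have sub: "u \<le> \<bar>x * y\<bar> \<Longrightarrow> a \<le> \<bar>x\<bar> \<or> b \<le> \<bar>y\<bar>" for x y :: real
  proof (rule ccontr)
    assume "u \<le> \<bar>x * y\<bar>" "\<not> (a \<le> \<bar>x\<bar> \<or> b \<le> \<bar>y\<bar>)"
    then have "\<bar>x\<bar> * \<bar>y\<bar> < a * b" by (intro mult_strict_mono') auto
    with \<open>a * b = u\<close> \<open>u \<le> \<bar>x * y\<bar>\<close> show False by (simp add: abs_mult)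
  qed
  have "prob {\<omega> \<in> space M. u \<le> \<bar>X \<omega> * Y \<omega>\<bar>} \<le>
      prob ({\<omega> \<in> space M. a \<le> \<bar>X \<omega>\<bar>} \<union> {\<omega> \<in> space M. b \<le> \<bar>Y \<omega>\<bar>})"
    using sub by (intro finite_measure_mono) auto
  also have "\<dots> \<le> prob {\<omega> \<in> space M. a \<le> \<bar>X \<omega>\<bar>} + prob {\<omega> \<in> space M. b \<le> \<bar>Y \<omega>\<bar>}"
    by (intro measure_Un_le) auto
  also have "\<dots> \<le> K1 * exp (- K2 * a powr \<gamma>1) + K1 * exp (- K2 * b powr \<gamma>2)"
    using ab by (intro add_mono X Y)
  also have "a powr \<gamma>1 = u powr (\<gamma>1 * \<gamma>2 / (\<gamma>1 + \<gamma>2))"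
    by (simp add: a_def powr_powr mult.commute)
  also have "b powr \<gamma>2 = u powr (\<gamma>1 * \<gamma>2 / (\<gamma>1 + \<gamma>2))"
    by (simp add: b_def powr_powr)
  finally show ?thesis by simp
qed

text \<open>
  The weight uses half of the tail rate \<open>K2\<close>, the polynomial factor another quarter, which leaves
  an exponential moment of order \<open>3/4\<close> in the normalised variable \<open>K2 |Z|\<^sup>\<gamma>\<close>.  What matters is
  that the bound \<open>D\<close> is chosen before the distribution.
\<close>

lemma subweibull_weighted_moment:
  fixes K1 K2 \<gamma> :: real
  assumes "0 < K1" "0 < K2" "0 < \<gamma>"
  shows "\<exists>D>0. \<forall>(M :: 'a measure) Z. prob_space M \<longrightarrow> Z \<in> borel_measurable M \<longrightarrow>
    (\<forall>u>0. measure M {\<omega> \<in> space M. u \<le> \<bar>Z \<omega>\<bar>} \<le> 2 * K1 * exp (- K2 * u powr \<gamma>)) \<longrightarrow>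
    integrable M (\<lambda>\<omega>. (Z \<omega>)\<^sup>2 * exp (K2 / 2 * (1 + \<bar>Z \<omega>\<bar> powr \<gamma>))) \<and>
    (\<integral>\<omega>. (Z \<omega>)\<^sup>2 * exp (K2 / 2 * (1 + \<bar>Z \<omega>\<bar> powr \<gamma>)) \<partial>M) \<le> D"
proof -
  define B where "B = exp (K2 / 2) * ((2 / \<gamma>) / (K2 / 4)) powr (2 / \<gamma>)"
  define K where "K = max 1 (2 * K1)"
  define D where "D = B * (K * exp (3/4) / (1 - exp (-1/4)))"
  have "0 < B" "0 < K" using assms by (auto simp: B_def K_def)
  then have "0 < D" unfolding D_def by (intro mult_pos_pos divide_pos_pos) auto
  have pointwise: "z\<^sup>2 * exp (K2 / 2 * (1 + \<bar>z\<bar> powr \<gamma>)) \<le> B * exp (3/4 * (K2 * \<bar>z\<bar> powr \<gamma>))" for z :: real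
  proof -
    have "z\<^sup>2 = (\<bar>z\<bar> powr \<gamma>) powr (2 / \<gamma>)"
      using assms by (simp add: powr_powr)
    also have "\<dots> \<le> ((2 / \<gamma>) / (K2 / 4)) powr (2 / \<gamma>) * exp (K2 / 4 * \<bar>z\<bar> powr \<gamma>)"
      using assms by (intro powr_le_exp) auto
    finally have "z\<^sup>2 * exp (K2 / 2 * (1 + \<bar>z\<bar> powr \<gamma>)) \<le>
      ((2 / \<gamma>) / (K2 / 4)) powr (2 / \<gamma>) * exp (K2 / 4 * \<bar>z\<bar> powr \<gamma>) * exp (K2 / 2 * (1 + \<bar>z\<bar> powr \<gamma>))"
      by (rule mult_right_mono) simp
    also have "\<dots> = B * exp (3/4 * (K2 * \<bar>z\<bar> powr \<gamma>))"
      by (simp add: B_def exp_add[symmetric] algebra_simps)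
    finally show ?thesis .
  qed
  have main: "integrable M (\<lambda>\<omega>. (Z \<omega>)\<^sup>2 * exp (K2 / 2 * (1 + \<bar>Z \<omega>\<bar> powr \<gamma>))) \<and>
      (\<integral>\<omega>. (Z \<omega>)\<^sup>2 * exp (K2 / 2 * (1 + \<bar>Z \<omega>\<bar> powr \<gamma>)) \<partial>M) \<le> D"
    if "prob_space M" and Z [measurable]: "Z \<in> borel_measurable M"
      and tail: "\<And>u. 0 < u \<Longrightarrow> measure M {\<omega> \<in> space M. u \<le> \<bar>Z \<omega>\<bar>} \<le> 2 * K1 * exp (- K2 * u powr \<gamma>)"
    for M :: "'a measure" and Z
  proof -
    interpret prob_space M by fact
    define V where "V \<omega> = K2 * \<bar>Z \<omega>\<bar> powr \<gamma>" for \<omega>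
    have [measurable]: "V \<in> borel_measurable M" unfolding V_def by measurable
    have tailV: "prob {\<omega> \<in> space M. real k \<le> V \<omega>} \<le> K * exp (- real k)" for k
    proof (cases "k = 0")
      case True
      have "prob {\<omega> \<in> space M. real k \<le> V \<omega>} \<le> 1" by (rule prob_le_1)
      also have "1 \<le> K" by (simp add: K_def)
      finally show ?thesis using True by simp
    next
      case False
      define u where "u = (real k / K2) powr (1 / \<gamma>)"
      have u: "0 < u" "K2 * u powr \<gamma> = real k"
        using assms False by (auto simp: u_def powr_powr)
      have "u \<le> \<bar>z\<bar>" if "real k \<le> K2 * \<bar>z\<bar> powr \<gamma>" for z :: real
      proof (rule ccontr)
        assume "\<not> u \<le> \<bar>z\<bar>"
        then have "\<bar>z\<bar> powr \<gamma> < u powr \<gamma>" using assms by (intro powr_less_mono2) auto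
        then have "K2 * \<bar>z\<bar> powr \<gamma> < K2 * u powr \<gamma>" using assms by simp
        with that u(2) show False by linarith
      qed
      then have "prob {\<omega> \<in> space M. real k \<le> V \<omega>} \<le> prob {\<omega> \<in> space M. u \<le> \<bar>Z \<omega>\<bar>}"
        by (intro finite_measure_mono) (auto simp: V_def)
      also have "\<dots> \<le> 2 * K1 * exp (- real k)"
        using tail[OF u(1)] u(2) by simp
      also have "\<dots> \<le> K * exp (- real k)"
        by (intro mult_right_mono) (auto simp: K_def)
      finally show ?thesis .
    qed
    have "(\<integral>\<^sup>+\<omega>. ennreal ((Z \<omega>)\<^sup>2 * exp (K2 / 2 * (1 + \<bar>Z \<omega>\<bar> powr \<gamma>))) \<partial>M) \<le>
        (\<integral>\<^sup>+\<omega>. ennreal B * ennreal (exp (3/4 * V \<omega>)) \<partial>M)"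
      using pointwise \<open>0 < B\<close>
      by (intro nn_integral_mono) (auto simp: V_def ennreal_mult[symmetric] intro!: ennreal_leI)
    also have "\<dots> = ennreal B * (\<integral>\<^sup>+\<omega>. ennreal (exp (3/4 * V \<omega>)) \<partial>M)"
      by (intro nn_integral_cmult) simp
    also have "\<dots> \<le> ennreal B * ennreal (K * exp (3/4) / (1 - exp (-1/4)))"
      using assms \<open>0 < K\<close> tailV by (intro mult_left_mono exp_tail_imp_exp_moment) (auto simp: V_def)
    also have "\<dots> = ennreal D"
      unfolding D_def using \<open>0 < B\<close> \<open>0 < K\<close> by (intro ennreal_mult[symmetric]) auto
    finally have le: "(\<integral>\<^sup>+\<omega>. ennreal ((Z \<omega>)\<^sup>2 * exp (K2 / 2 * (1 + \<bar>Z \<omega>\<bar> powr \<gamma>))) \<partial>M) \<le> ennreal D" .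
    have int: "integrable M (\<lambda>\<omega>. (Z \<omega>)\<^sup>2 * exp (K2 / 2 * (1 + \<bar>Z \<omega>\<bar> powr \<gamma>)))"
      using le by (intro integrableI_nonneg) (auto intro: le_less_trans)
    moreover have "(\<integral>\<omega>. (Z \<omega>)\<^sup>2 * exp (K2 / 2 * (1 + \<bar>Z \<omega>\<bar> powr \<gamma>)) \<partial>M) \<le> D"
      using le \<open>0 < D\<close> nn_integral_eq_integral[OF int] by (simp add: ennreal_le_iff)
    ultimately show ?thesis ..
  qed
  show ?thesis
    by (intro exI[of _ D] conjI[OF \<open>0 < D\<close>] allI impI main) simp_all
qed

text \<open>
  Sub-Weibull variables with \<open>\<gamma> < 1\<close> need not have a moment generating function, but on \<open>|Z| \<le> m\<close> the
  exponent \<open>t |Z|\<close> is dominated by \<open>h (1 + |Z|\<^sup>\<gamma>)\<close>, and the weighted second moment then controls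
  the quadratic remainder of the exponential.  The weight also controls the mean that is lost by
  truncation, because its exponential factor is at least \<open>exp (h m\<^sup>\<gamma>)\<close> where \<open>|Z| > m\<close>; this is the last term of the bound.
\<close>

lemma (in prob_space) truncated_mgf_bound:
  fixes Z :: "'a \<Rightarrow> real" and h \<gamma> D t m :: real
  defines "G \<equiv> \<lambda>z::real. z\<^sup>2 * exp (h * (1 + \<bar>z\<bar> powr \<gamma>))"
  assumes [measurable]: "Z \<in> borel_measurable M"
    and G: "integrable M (\<lambda>\<omega>. G (Z \<omega>))" "expectation (\<lambda>\<omega>. G (Z \<omega>)) \<le> D"
    and pos: "0 \<le> h" "0 < \<gamma>" "0 \<le> t" "1 \<le> m"
    and th: "\<And>z. \<bar>z\<bar> \<le> m \<Longrightarrow> t * \<bar>z\<bar> \<le> h * (1 + \<bar>z\<bar> powr \<gamma>)"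
  shows "expectation (\<lambda>\<omega>. if \<bar>Z \<omega>\<bar> \<le> m then exp (- t * Z \<omega>) else 0) \<le>
    exp (- t * expectation Z + t\<^sup>2 * D + t * exp (- h * m powr \<gamma>) * D)"
proof -
  have G_nonneg: "0 \<le> G z" for z by (simp add: G_def)
  have sq_le_G: "z\<^sup>2 \<le> G z" for z
    using mult_left_mono[of 1 "exp (h * (1 + \<bar>z\<bar> powr \<gamma>))" "z\<^sup>2"] pos by (simp add: G_def)
  have intZ: "integrable M Z"
  proof (rule Bochner_Integration.integrable_bound)
    show "integrable M (\<lambda>\<omega>. 1 + G (Z \<omega>))" using G(1) by simp
    have "\<bar>z\<bar> \<le> 1 + z\<^sup>2" for z :: real
      using zero_le_power2[of "\<bar>z\<bar> - 1/2"] by (simp add: power2_diff power_one_over)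
    then have "\<bar>z\<bar> \<le> \<bar>1 + G z\<bar>" for z
      using sq_le_G[of z] G_nonneg[of z] by (smt (verit))
    then show "AE \<omega> in M. norm (Z \<omega>) \<le> norm (1 + G (Z \<omega>))"
      by simp
  qed simp
  have pointwise: "(if \<bar>z\<bar> \<le> m then exp (- t * z) else 0) \<le>
      1 - t * z + (t\<^sup>2 + t * exp (- h * m powr \<gamma>)) * G z" for z
  proof (cases "\<bar>z\<bar> \<le> m")
    case True
    have "exp (- t * z) \<le> 1 - t * z + t\<^sup>2 * (z\<^sup>2 * exp (t * \<bar>z\<bar>))"
      using exp_le_quadratic_remainder[of "- t * z"] pos
      by (simp add: abs_mult power_mult_distrib mult.assoc)
    also have "\<dots> \<le> 1 - t * z + t\<^sup>2 * G z"
      unfolding G_def using th[OF True] by (intro add_left_mono mult_left_mono) auto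
    also have "\<dots> \<le> 1 - t * z + (t\<^sup>2 + t * exp (- h * m powr \<gamma>)) * G z"
      using pos G_nonneg by (intro add_left_mono mult_right_mono) auto
    finally show ?thesis using True by simp
  next
    case False
    have "\<bar>z\<bar> \<le> z\<^sup>2"
      using False pos mult_right_mono[of 1 "\<bar>z\<bar>" "\<bar>z\<bar>"] by (simp add: power2_eq_square)
    also have "z\<^sup>2 = exp (- h * m powr \<gamma>) * (z\<^sup>2 * exp (h * m powr \<gamma>))"
      by (simp add: exp_minus)
    also have "\<dots> \<le> exp (- h * m powr \<gamma>) * G z"
    proof -
      have "m powr \<gamma> \<le> \<bar>z\<bar> powr \<gamma>" using False pos by (intro powr_mono2) auto
      then have "h * m powr \<gamma> \<le> h * (1 + \<bar>z\<bar> powr \<gamma>)"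
        using pos by (intro mult_left_mono) auto
      then show ?thesis unfolding G_def by (intro mult_left_mono) auto
    qed
    finally have "t * \<bar>z\<bar> \<le> t * (exp (- h * m powr \<gamma>) * G z)"
      using pos by (intro mult_left_mono)
    moreover have "t * z \<le> t * \<bar>z\<bar>" using pos by (intro mult_left_mono) auto
    moreover have "0 \<le> t\<^sup>2 * G z" using G_nonneg by simp
    ultimately show ?thesis using False by (simp add: algebra_simps)
  qed
  have "expectation (\<lambda>\<omega>. if \<bar>Z \<omega>\<bar> \<le> m then exp (- t * Z \<omega>) else 0) \<le>
      expectation (\<lambda>\<omega>. 1 - t * Z \<omega> + (t\<^sup>2 + t * exp (- h * m powr \<gamma>)) * G (Z \<omega>))"
  proof (rule integral_mono)
    show "integrable M (\<lambda>\<omega>. if \<bar>Z \<omega>\<bar> \<le> m then exp (- t * Z \<omega>) else 0)"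
    proof (rule integrable_const_bound[of _ "exp (t * m)"])
      have "- t * z \<le> t * m" if "\<bar>z\<bar> \<le> m" for z
        using pos that mult_left_mono[of "- z" m t] by simp
      then show "AE \<omega> in M. norm (if \<bar>Z \<omega>\<bar> \<le> m then exp (- t * Z \<omega>) else 0) \<le> exp (t * m)"
        by (intro AE_I2) auto
    qed measurable
    show "integrable M (\<lambda>\<omega>. 1 - t * Z \<omega> + (t\<^sup>2 + t * exp (- h * m powr \<gamma>)) * G (Z \<omega>))"
      using intZ G(1) by simp
  qed (rule pointwise)
  also have "\<dots> = 1 - t * expectation Z + (t\<^sup>2 + t * exp (- h * m powr \<gamma>)) * expectation (\<lambda>\<omega>. G (Z \<omega>))"
    using intZ G(1) by (simp add: prob_space)
  also have "\<dots> \<le> 1 + (- t * expectation Z + (t\<^sup>2 + t * exp (- h * m powr \<gamma>)) * D)"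
    using mult_left_mono[OF G(2), of "t\<^sup>2 + t * exp (- h * m powr \<gamma>)"] pos by simp
  also have "\<dots> \<le> exp (- t * expectation Z + (t\<^sup>2 + t * exp (- h * m powr \<gamma>)) * D)"
    by (rule exp_ge_add_one_self)
  finally show ?thesis by (simp add: algebra_simps)
qed

text \<open>
  Restricting each factor of the Chernoff product to \<open>|W\<^sub>i| \<le> m\<close> makes the moment generating
  function finite while the summands stay untruncated, and independence still factorises the product.
\<close>

lemma (in prob_space) truncated_chernoff:
  fixes W :: "'i \<Rightarrow> 'a \<Rightarrow> real"
  assumes I: "finite I" and ind: "indep_vars (\<lambda>_. borel) W I" and t: "0 \<le> t" and q: "0 \<le> q"
    and mgf: "\<And>i. i \<in> I \<Longrightarrow>
      expectation (\<lambda>\<omega>. if \<bar>W i \<omega>\<bar> \<le> m then exp (- t * W i \<omega>) else 0) \<le> q"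
  shows "prob {\<omega> \<in> space M. (\<forall>i\<in>I. \<bar>W i \<omega>\<bar> \<le> m) \<and> (\<Sum>i\<in>I. W i \<omega>) \<le> x} \<le> exp (t * x) * q ^ card I"
    (is "prob ?A \<le> _")
proof -
  define f where "f w = (if \<bar>w\<bar> \<le> m then exp (- t * w) else 0)" for w :: real
  have [measurable]: "f \<in> borel_measurable borel" unfolding f_def by measurable
  have f_nonneg: "0 \<le> f w" for w by (simp add: f_def)
  have W [measurable]: "i \<in> I \<Longrightarrow> W i \<in> borel_measurable M" for i
    using ind by (auto simp: indep_vars_def)
  have A: "?A \<in> events"
    using I by measurable
  have indf: "indep_vars (\<lambda>_. borel) (\<lambda>i \<omega>. f (W i \<omega>)) I"
    using ind by (rule indep_vars_compose2) simp
  have f_bound: "norm (f w) \<le> exp (t * m)" for w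
    using t mult_left_mono[of "- w" m t] by (auto simp: f_def)
  have intf: "integrable M (\<lambda>\<omega>. f (W i \<omega>))" if "i \<in> I" for i
    using W[OF that] f_bound by (intro integrable_const_bound[of _ "exp (t * m)"]) auto
  have int: "integrable M (\<lambda>\<omega>. \<Prod>i\<in>I. f (W i \<omega>))"
    using I indf intf by (rule indep_vars_integrable)
  have "prob ?A = expectation (indicator ?A)"
    using A by simp
  also have "\<dots> \<le> expectation (\<lambda>\<omega>. exp (t * x) * (\<Prod>i\<in>I. f (W i \<omega>)))"
  proof (rule integral_mono)
    show "integrable M (indicator ?A :: _ \<Rightarrow> real)"
      by (intro integrable_real_indicator A) (simp add: emeasure_eq_measure)
    show "integrable M (\<lambda>\<omega>. exp (t * x) * (\<Prod>i\<in>I. f (W i \<omega>)))" using int by simp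
    fix \<omega> assume "\<omega> \<in> space M"
    show "indicator ?A \<omega> \<le> exp (t * x) * (\<Prod>i\<in>I. f (W i \<omega>))"
    proof (cases "\<omega> \<in> ?A")
      case True
      then have "(\<Prod>i\<in>I. f (W i \<omega>)) = exp (- t * (\<Sum>i\<in>I. W i \<omega>))"
        using I by (simp add: f_def sum_distrib_left exp_sum)
      moreover have "t * (\<Sum>i\<in>I. W i \<omega>) \<le> t * x" using True t by (intro mult_left_mono) auto
      ultimately show ?thesis using True by (simp flip: exp_add)
    qed (simp add: prod_nonneg f_nonneg)
  qed
  also have "\<dots> = exp (t * x) * (\<Prod>i\<in>I. expectation (\<lambda>\<omega>. f (W i \<omega>)))"
    using indep_vars_lebesgue_integral[OF I indf intf] by simp
  also have "(\<Prod>i\<in>I. expectation (\<lambda>\<omega>. f (W i \<omega>))) \<le> (\<Prod>i\<in>I. q)"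
    using mgf by (intro prod_mono) (auto simp: f_def intro!: integral_nonneg)
  finally show ?thesis by simp
qed

section \<open>Probability of missing one covariate\<close>

lemma product_measurable_observation:
  assumes "j \<in> {1..p}"
  shows "(\<lambda>(x, y). x j * y) \<in> observation_space p \<rightarrow>\<^sub>M (borel :: real measure)"
proof -
  have [measurable]: "(\<lambda>x. x j) \<in> covariate_space p \<rightarrow>\<^sub>M borel"
    unfolding covariate_space_def using assms by (rule measurable_component_singleton)
  show ?thesis unfolding observation_space_def by measurable
qed

lemma observation_components_measurable:
  assumes "observation p X Y \<in> M \<rightarrow>\<^sub>M observation_space p"
  shows "j \<in> {1..p} \<Longrightarrow> X j \<in> borel_measurable M" "Y \<in> borel_measurable M"
proof -
  assume j: "j \<in> {1..p}"
  have c: "(\<lambda>x. x j) \<in> covariate_space p \<rightarrow>\<^sub>M borel"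
    unfolding covariate_space_def using j by (rule measurable_component_singleton)
  have "(\<lambda>x. fst x j) \<in> observation_space p \<rightarrow>\<^sub>M borel"
    unfolding observation_space_def by (rule measurable_compose[OF measurable_fst c])
  from measurable_compose[OF assms this] show "X j \<in> borel_measurable M"
    using j by (simp add: observation_def covariate_vector_def)
next
  have "snd \<in> observation_space p \<rightarrow>\<^sub>M borel"
    unfolding observation_space_def by (rule measurable_snd)
  from measurable_compose[OF assms this] show "Y \<in> borel_measurable M"
    by (simp add: observation_def)
qed

lemma iid_copies_product:
  assumes M: "prob_space M" and obs: "observation p X Y \<in> M \<rightarrow>\<^sub>M observation_space p"
    and iid: "iid_copies M n p X Y Xs Ys" and j: "j \<in> {1..p}"
  shows "prob_space.indep_vars M (\<lambda>_. borel) (\<lambda>i \<omega>. Xs i j \<omega> * Ys i \<omega>) {1..n}"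
    and "i \<in> {1..n} \<Longrightarrow> distr M borel (\<lambda>\<omega>. Xs i j \<omega> * Ys i \<omega>) = distr M borel (\<lambda>\<omega>. X j \<omega> * Y \<omega>)"
proof -
  interpret prob_space M by (rule M)
  define f :: "(nat \<Rightarrow> real) \<times> real \<Rightarrow> real" where "f = (\<lambda>(x, y). x j * y)"
  have f: "f \<in> observation_space p \<rightarrow>\<^sub>M borel"
    unfolding f_def using j by (rule product_measurable_observation)
  have f_obs: "f (observation p X Y \<omega>) = X j \<omega> * Y \<omega>" for X :: "nat \<Rightarrow> 'a \<Rightarrow> real" and Y \<omega>
    using j by (simp add: f_def observation_def covariate_vector_def)
  have ind: "indep_vars (\<lambda>_. observation_space p) (\<lambda>i. observation p (Xs i) (Ys i)) {1..n}"
    using iid by (simp add: iid_copies_def)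
  show "indep_vars (\<lambda>_. borel) (\<lambda>i \<omega>. Xs i j \<omega> * Ys i \<omega>) {1..n}"
    using indep_vars_compose2[OF ind, of "\<lambda>_. f" "\<lambda>_. borel"] f by (simp add: f_obs)
  assume i: "i \<in> {1..n}"
  have obs_i: "observation p (Xs i) (Ys i) \<in> M \<rightarrow>\<^sub>M observation_space p"
    using ind i by (auto simp: indep_vars_def)
  have "distr (distr M (observation_space p) (observation p (Xs i) (Ys i))) borel f =
      distr (distr M (observation_space p) (observation p X Y)) borel f"
    using iid i by (simp add: iid_copies_def)
  then show "distr M borel (\<lambda>\<omega>. Xs i j \<omega> * Ys i \<omega>) = distr M borel (\<lambda>\<omega>. X j \<omega> * Y \<omega>)"
    by (simp add: distr_distr[OF f obs_i] distr_distr[OF f obs] comp_def f_obs)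
qed

lemma (in prob_space) distr_eq_transfer:
  fixes U V :: "'a \<Rightarrow> real" and f :: "real \<Rightarrow> real"
  assumes "U \<in> borel_measurable M" "V \<in> borel_measurable M" "distr M borel U = distr M borel V"
    and [measurable]: "f \<in> borel_measurable borel"
  shows "expectation (\<lambda>\<omega>. f (U \<omega>)) = expectation (\<lambda>\<omega>. f (V \<omega>))"
  using assms(3) integral_distr[OF assms(1), of f] integral_distr[OF assms(2), of f] by simp

text \<open>
  If every observation has size at most \<open>m\<close> and their sum, with the sign of the mean, is above
  \<open>n b / 2\<close>, then the dual bound with the fixed multiplier \<open>\<theta>\<close> reaches the threshold \<open>T\<close>: the sum
  of squares is bounded trivially by \<open>n m\<^sup>2\<close>.  So non-selection requires a large observation or a
  sum that falls short by half of the signal, and these are the two terms on the right.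
\<close>

lemma (in prob_space) nonselection_bound:
  fixes Z :: "'a \<Rightarrow> real" and W :: "nat \<Rightarrow> 'a \<Rightarrow> real" and h \<gamma> D t m b T \<theta> q :: real
  assumes n: "1 \<le> n"
    and ind: "indep_vars (\<lambda>_. borel) W {1..n}"
    and Z [measurable]: "Z \<in> borel_measurable M"
    and same: "\<And>i. i \<in> {1..n} \<Longrightarrow> distr M borel (W i) = distr M borel Z"
    and moment: "integrable M (\<lambda>\<omega>. (Z \<omega>)\<^sup>2 * exp (h * (1 + \<bar>Z \<omega>\<bar> powr \<gamma>)))"
      "expectation (\<lambda>\<omega>. (Z \<omega>)\<^sup>2 * exp (h * (1 + \<bar>Z \<omega>\<bar> powr \<gamma>))) \<le> D"
    and tail: "prob {\<omega> \<in> space M. m \<le> \<bar>Z \<omega>\<bar>} \<le> q"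
    and signal: "b \<le> \<bar>expectation Z\<bar>" "0 \<le> b"
    and pos: "0 \<le> h" "0 < \<gamma>" "0 \<le> t" "1 \<le> m"
    and th: "\<And>z. \<bar>z\<bar> \<le> m \<Longrightarrow> t * \<bar>z\<bar> \<le> h * (1 + \<bar>z\<bar> powr \<gamma>)"
    and small: "t * D \<le> b / 8" "exp (- h * m powr \<gamma>) * D \<le> b / 8"
    and dual: "0 \<le> \<theta>" "\<theta> * m \<le> 1/2" "T \<le> real n * \<theta> * b - 4 * real n * (\<theta> * m)\<^sup>2"
  shows "prob {\<omega> \<in> space M. \<not> ereal T \<le> EL_ratio n (\<lambda>i. W i \<omega>)} \<le>
    real n * q + exp (- (t * b * real n / 4))"
proof -
  have W [measurable]: "i \<in> {1..n} \<Longrightarrow> W i \<in> borel_measurable M" for i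
    using ind by (auto simp: indep_vars_def)
  \<comment> \<open>The mean may have either sign; \<open>\<sigma>\<close> reduces to the lower tail of a positive mean.\<close>
  define \<sigma> :: real where "\<sigma> = (if 0 \<le> expectation Z then 1 else - 1)"
  have \<sigma>: "\<bar>\<sigma>\<bar> = 1" "\<sigma>\<^sup>2 = 1" "\<sigma> * expectation Z = \<bar>expectation Z\<bar>"
    by (auto simp: \<sigma>_def)
  define A where "A = (\<Union>i\<in>{1..n}. {\<omega> \<in> space M. m \<le> \<bar>W i \<omega>\<bar>})"
  define B where "B = {\<omega> \<in> space M. (\<forall>i\<in>{1..n}. \<bar>\<sigma> * W i \<omega>\<bar> \<le> m) \<and>
    (\<Sum>i=1..n. \<sigma> * W i \<omega>) \<le> real n * b / 2}"
  have AB [measurable]: "A \<in> events" "B \<in> events"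
    unfolding A_def B_def by measurable
  have "ereal T \<le> EL_ratio n (\<lambda>i. W i \<omega>)" if "\<omega> \<in> space M" "\<omega> \<notin> A" "\<omega> \<notin> B" for \<omega>
  proof (rule EL_ratio_dual_bound[where \<theta> = "\<theta> * \<sigma>"])
    have le: "\<bar>W i \<omega>\<bar> \<le> m" if "i \<in> {1..n}" for i
    proof -
      have "\<not> m \<le> \<bar>W i \<omega>\<bar>"
        using \<open>\<omega> \<notin> A\<close> \<open>\<omega> \<in> space M\<close> that unfolding A_def by blast
      then show ?thesis by linarith
    qed
    then have sum: "real n * b / 2 \<le> \<sigma> * (\<Sum>i=1..n. W i \<omega>)"
      using that \<sigma>(1) by (auto simp: B_def abs_mult sum_distrib_left not_le)
    show "\<bar>\<theta> * \<sigma> * W i \<omega>\<bar> \<le> 1/2" if "i \<in> {1..n}" for i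
      using mult_left_mono[OF le[OF that] dual(1)] dual(1,2) \<sigma>(1) by (simp add: abs_mult)
    have "(\<Sum>i=1..n. (W i \<omega>)\<^sup>2) \<le> (\<Sum>i=1..n. m\<^sup>2)"
      using le pos(4) by (intro sum_mono) (simp add: abs_le_square_iff[symmetric])
    then have "\<theta>\<^sup>2 * (\<Sum>i=1..n. (W i \<omega>)\<^sup>2) \<le> \<theta>\<^sup>2 * (\<Sum>i=1..n. m\<^sup>2)"
      by (rule mult_left_mono) simp
    then have "\<theta>\<^sup>2 * (\<Sum>i=1..n. (W i \<omega>)\<^sup>2) \<le> real n * (\<theta> * m)\<^sup>2"
      by (simp add: power_mult_distrib mult.left_commute)
    moreover have "\<theta> * (real n * b / 2) \<le> \<theta> * (\<sigma> * (\<Sum>i=1..n. W i \<omega>))"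
      using sum dual(1) by (rule mult_left_mono)
    ultimately show "T \<le> 2 * (\<theta> * \<sigma> * (\<Sum>i=1..n. W i \<omega>) - 2 * (\<theta> * \<sigma>)\<^sup>2 * (\<Sum>i=1..n. (W i \<omega>)\<^sup>2))"
      using dual(3) \<sigma>(2) by (simp add: power_mult_distrib algebra_simps)
  qed (rule n)
  then have "prob {\<omega> \<in> space M. \<not> ereal T \<le> EL_ratio n (\<lambda>i. W i \<omega>)} \<le> prob (A \<union> B)"
    by (intro finite_measure_mono) auto
  also have "\<dots> \<le> prob A + prob B"
    by (intro measure_Un_le AB)
  also have "prob A \<le> (\<Sum>i=1..n. prob {\<omega> \<in> space M. m \<le> \<bar>W i \<omega>\<bar>})"
    unfolding A_def by (intro finite_measure_subadditive_finite) auto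
  also have "\<dots> \<le> (\<Sum>i=1..n. q)"
  proof (rule sum_mono)
    fix i assume i: "i \<in> {1..n}"
    have "measure (distr M borel (W i)) {z. m \<le> \<bar>z\<bar>} = measure (distr M borel Z) {z. m \<le> \<bar>z\<bar>}"
      using same[OF i] by simp
    then have "prob {\<omega> \<in> space M. m \<le> \<bar>W i \<omega>\<bar>} = prob {\<omega> \<in> space M. m \<le> \<bar>Z \<omega>\<bar>}"
      using W[OF i] by (simp add: measure_distr vimage_def Int_def conj_commute)
    with tail show "prob {\<omega> \<in> space M. m \<le> \<bar>W i \<omega>\<bar>} \<le> q" by simp
  qed
  also have "prob B \<le> exp (t * (real n * b / 2)) * exp (- (3/4 * t * b)) ^ card {1..n}"
    unfolding B_def
  proof (rule truncated_chernoff)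
    show "indep_vars (\<lambda>_. borel) (\<lambda>i \<omega>. \<sigma> * W i \<omega>) {1..n}"
      using ind by (rule indep_vars_compose2) simp
    fix i assume i: "i \<in> {1..n}"
    define f where "f z = (if \<bar>\<sigma> * z\<bar> \<le> m then exp (- t * (\<sigma> * z)) else 0)" for z
    have [measurable]: "f \<in> borel_measurable borel" unfolding f_def by measurable
    have "expectation (\<lambda>\<omega>. f (W i \<omega>)) = expectation (\<lambda>\<omega>. f (Z \<omega>))"
      using W[OF i] Z same[OF i] by (rule distr_eq_transfer) simp
    also have "\<dots> \<le> exp (- t * expectation (\<lambda>\<omega>. \<sigma> * Z \<omega>) + t\<^sup>2 * D + t * exp (- h * m powr \<gamma>) * D)"
      unfolding f_def using moment pos th \<sigma>(1,2)
      by (intro truncated_mgf_bound) (auto simp: abs_mult power_mult_distrib)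
    \<comment> \<open>Quadratic remainder and truncation bias each cost at most an eighth of the signal.\<close>
    also have "\<dots> \<le> exp (- (3/4 * t * b))"
    proof -
      have "t * b \<le> t * expectation (\<lambda>\<omega>. \<sigma> * Z \<omega>)"
        using signal(1) \<sigma>(3) pos(3) by (intro mult_left_mono) simp_all
      moreover have "t * (t * D) \<le> t * (b / 8)" "t * (exp (- h * m powr \<gamma>) * D) \<le> t * (b / 8)"
        using small pos(3) by (simp_all only: mult_left_mono)
      ultimately show ?thesis by (simp add: power2_eq_square algebra_simps)
    qed
    finally show "expectation (\<lambda>\<omega>. if \<bar>\<sigma> * W i \<omega>\<bar> \<le> m then exp (- t * (\<sigma> * W i \<omega>)) else 0) \<le>
        exp (- (3/4 * t * b))"
      by (simp add: f_def)
  qed (use pos in auto)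
  also have "\<dots> = exp (- (t * b * real n / 4))"
    by (simp add: exp_of_nat_mult[symmetric] exp_add[symmetric] algebra_simps)
  finally show ?thesis by simp
qed

section \<open>Asymptotic comparison of the rates\<close>

text \<open>
  For \<open>\<gamma> < 1\<close> a linear exponent is dominated by a power \<open>|z|\<^sup>\<gamma>\<close> only up to the truncation level,
  through \<open>|z| = |z|\<^sup>\<gamma> |z|\<^bsup>1-\<gamma>\<^esup>\<close>; this forces the Chernoff parameter down to the order
  \<open>x powr (- a (1 - \<gamma>))\<close>.  The order \<open>x powr (- \<kappa>)\<close> is what the quadratic remainder allows.
\<close>

lemma linear_le_subweibull_exponent:
  fixes \<epsilon> h x a \<gamma> \<kappa> z :: real
  assumes "0 \<le> \<epsilon>" "\<epsilon> \<le> h" "0 < \<gamma>" "0 \<le> a" "0 \<le> \<kappa>" "1 \<le> x" and z: "\<bar>z\<bar> \<le> x powr a"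
  shows "\<epsilon> * x powr - max \<kappa> (a * (1 - \<gamma>)) * \<bar>z\<bar> \<le> h * (1 + \<bar>z\<bar> powr \<gamma>)"
proof -
  have "x powr - max \<kappa> (a * (1 - \<gamma>)) * \<bar>z\<bar> \<le> 1 + \<bar>z\<bar> powr \<gamma>"
  proof (cases "\<bar>z\<bar> \<le> 1")
    case True
    have "x powr - max \<kappa> (a * (1 - \<gamma>)) \<le> x powr 0"
      using assms by (intro powr_mono) auto
    then have "x powr - max \<kappa> (a * (1 - \<gamma>)) * \<bar>z\<bar> \<le> 1 * 1"
      using True assms by (intro mult_mono) auto
    then show ?thesis by (smt (verit) powr_ge_zero)
  next
    case False
    have "x powr - max \<kappa> (a * (1 - \<gamma>)) * \<bar>z\<bar> powr (1 - \<gamma>) \<le> 1"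
    proof (cases "\<gamma> \<le> 1")
      case True
      have "\<bar>z\<bar> powr (1 - \<gamma>) \<le> (x powr a) powr (1 - \<gamma>)"
        using z True False by (intro powr_mono2) auto
      then have "x powr - max \<kappa> (a * (1 - \<gamma>)) * \<bar>z\<bar> powr (1 - \<gamma>) \<le>
          x powr - max \<kappa> (a * (1 - \<gamma>)) * x powr (a * (1 - \<gamma>))"
        by (intro mult_left_mono) (auto simp: powr_powr)
      also have "\<dots> = x powr (a * (1 - \<gamma>) - max \<kappa> (a * (1 - \<gamma>)))"
        by (simp flip: powr_add)
      also have "\<dots> \<le> x powr 0" using assms by (intro powr_mono) auto
      finally show ?thesis using assms by simp
    next
      case False
      have "x powr - max \<kappa> (a * (1 - \<gamma>)) \<le> x powr 0"
        using assms by (intro powr_mono) auto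
      moreover have "\<bar>z\<bar> powr (1 - \<gamma>) \<le> \<bar>z\<bar> powr 0"
        using False \<open>\<not> \<bar>z\<bar> \<le> 1\<close> by (intro powr_mono) auto
      then have "\<bar>z\<bar> powr (1 - \<gamma>) \<le> 1"
        using \<open>\<not> \<bar>z\<bar> \<le> 1\<close> by (simp split: if_splits)
      ultimately have "x powr - max \<kappa> (a * (1 - \<gamma>)) * \<bar>z\<bar> powr (1 - \<gamma>) \<le> 1 * 1"
        using assms \<open>\<not> \<bar>z\<bar> \<le> 1\<close> by (intro mult_mono) auto
      then show ?thesis by (simp only: mult_1)
    qed
    from mult_right_mono[OF this, of "\<bar>z\<bar> powr \<gamma>"]
    have "x powr - max \<kappa> (a * (1 - \<gamma>)) * (\<bar>z\<bar> powr (1 - \<gamma>) * \<bar>z\<bar> powr \<gamma>) \<le> \<bar>z\<bar> powr \<gamma>"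
      by (simp add: mult.assoc)
    then show ?thesis using False by (simp flip: powr_add)
  qed
  then have "\<epsilon> * (x powr - max \<kappa> (a * (1 - \<gamma>)) * \<bar>z\<bar>) \<le> h * (1 + \<bar>z\<bar> powr \<gamma>)"
    using assms by (intro mult_mono) auto
  then show ?thesis by (simp add: mult.assoc)
qed

lemma eventually_ln_le_powr:
  fixes A B e :: real
  assumes "0 < A" "0 < B" "0 < e"
  shows "\<forall>\<^sub>F n :: nat in sequentially. ln (A * real n) \<le> B * real n powr e"
  using assms by real_asymp

lemma eventually_const_le_powr:
  fixes A B e :: real
  assumes "0 < B" "0 < e"
  shows "\<forall>\<^sub>F n :: nat in sequentially. A \<le> B * real n powr e"
proof -
  have "filterlim (\<lambda>n. B * real n powr e) at_top sequentially"
    using assms by real_asymp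
  then show ?thesis by (simp add: filterlim_at_top)
qed

lemma eventually_const_plus_powr_le_powr:
  fixes A B C r \<rho> :: real
  assumes "0 < B" "0 < \<rho>" "r < \<rho> \<or> r = \<rho> \<and> C < B"
  shows "\<forall>\<^sub>F n :: nat in sequentially. A + C * real n powr r \<le> B * real n powr \<rho>"
proof -
  consider "r < \<rho>" | "r = \<rho>" "C < B" using assms by blast
  then show ?thesis
  proof cases
    case 1
    have "\<forall>\<^sub>F n :: nat in sequentially. A \<le> B / 2 * real n powr \<rho>"
      using assms by (intro eventually_const_le_powr) auto
    moreover have "\<forall>\<^sub>F n :: nat in sequentially. C \<le> B / 2 * real n powr (\<rho> - r)"
      using assms 1 by (intro eventually_const_le_powr) auto
    ultimately show ?thesis
    proof eventually_elim
      case (elim n)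
      have "C * real n powr r \<le> B / 2 * real n powr (\<rho> - r) * real n powr r"
        using elim(2) by (intro mult_right_mono) auto
      also have "\<dots> = B / 2 * real n powr \<rho>"
        by (simp flip: powr_add)
      finally show ?case using elim(1) by linarith
    qed
  next
    case 2
    have "\<forall>\<^sub>F n :: nat in sequentially. A \<le> (B - C) * real n powr \<rho>"
      using assms 2 by (intro eventually_const_le_powr) auto
    then show ?thesis
      by eventually_elim (simp add: 2 algebra_simps)
  qed
qed

text \<open>
  The first error term decays with exponent \<open>a \<gamma>\<close>; \<open>C\<close> uses at most half of its rate
  \<open>K2 / 4 powr \<gamma>\<close>, and the other half absorbs the factor \<open>n\<close>.  The constant \<open>c\<close> of the second error term
  restricts \<open>C\<close> only when the exponents \<open>r\<close> and \<open>\<rho>\<close> coincide.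
\<close>

lemma eventually_error_le_rate:
  fixes K1 K2 \<gamma> a c r \<rho> C :: real
  assumes pos: "0 < K1" "0 < K2" "0 < \<gamma>" "0 < a" "0 < c" "0 < \<rho>" "0 < C"
    and C: "C \<le> K2 / (2 * 4 powr \<gamma>)" and r: "r \<le> a * \<gamma>"
    and \<rho>: "r < \<rho> \<or> r = \<rho> \<and> C < c"
  shows "\<forall>\<^sub>F n :: nat in sequentially.
    real n * (2 * K1 * exp (- K2 * (real n powr a / 4) powr \<gamma>)) + exp (- (c * real n powr \<rho>))
      \<le> exp (- C * real n powr r)"
proof -
  have "\<forall>\<^sub>F n :: nat in sequentially. ln (4 * K1 * real n) \<le> K2 / (2 * 4 powr \<gamma>) * real n powr (a * \<gamma>)"
    using pos by (intro eventually_ln_le_powr) auto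
  moreover have "\<forall>\<^sub>F n :: nat in sequentially. ln 2 + C * real n powr r \<le> c * real n powr \<rho>"
    using pos \<rho> by (intro eventually_const_plus_powr_le_powr) auto
  ultimately show ?thesis using eventually_ge_at_top[of 1]
  proof eventually_elim
    case (elim n)
    have split: "K2 * (real n powr a / 4) powr \<gamma> =
        K2 / (2 * 4 powr \<gamma>) * real n powr (a * \<gamma>) + K2 / (2 * 4 powr \<gamma>) * real n powr (a * \<gamma>)"
      by (simp add: powr_divide powr_powr)
    have "C * real n powr r \<le> K2 / (2 * 4 powr \<gamma>) * real n powr (a * \<gamma>)"
      using C r pos elim(3) by (intro mult_mono powr_mono) auto
    with elim(1) split have "ln (4 * K1 * real n) - K2 * (real n powr a / 4) powr \<gamma> \<le> - C * real n powr r"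
      by simp
    then have "exp (ln (4 * K1 * real n) - K2 * (real n powr a / 4) powr \<gamma>) \<le> exp (- C * real n powr r)"
      by simp
    then have 1: "2 * (real n * (2 * K1 * exp (- K2 * (real n powr a / 4) powr \<gamma>))) \<le> exp (- C * real n powr r)"
      using pos elim(3) by (simp add: exp_diff exp_minus field_simps)
    have "exp (ln 2 - c * real n powr \<rho>) \<le> exp (- C * real n powr r)"
      using elim(2) by simp
    then have "2 * exp (- (c * real n powr \<rho>)) \<le> exp (- C * real n powr r)"
      by (simp add: exp_diff exp_minus field_simps)
    with 1 show ?case by linarith
  qed
qed

text \<open>
  The two regimes of the theorem have the same exponent.  For \<open>\<gamma> \<ge> 2\<close> the second regime forces
  \<open>\<kappa> = 0\<close>, where both first arguments equal \<open>1\<close>; for \<open>\<gamma> < 2\<close> the second argument is the smaller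
  one on both sides.
\<close>

lemma screening_exponent_eq:
  fixes \<gamma> \<delta> \<kappa> \<tau> :: real
  assumes "0 < \<gamma>" and \<delta>: "\<delta> = max (2 / \<gamma> - 1) 0" and "0 \<le> \<kappa>" "\<kappa> < 1/2" "0 < \<tau>" "\<tau> < 1/2 - \<kappa>"
    and big: "1 \<le> (1 - 2 * \<kappa>) * (1 + 2 * \<delta>)"
  shows "min ((1 - \<kappa>) / (1 + \<delta>)) ((1 - 2 * \<kappa> - 2 * \<tau>) * \<gamma> / 2) =
    min (1 - 2 * \<kappa>) ((1 - 2 * \<kappa> - 2 * \<tau>) * \<gamma> / 2)"
proof (cases "2 \<le> \<gamma>")
  case True
  then have "\<delta> = 0" using \<delta> by simp
  with big assms have "\<kappa> = 0" by simp
  with \<open>\<delta> = 0\<close> show ?thesis by simp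
next
  case False
  then have "1 + \<delta> = 2 / \<gamma>" using \<delta> assms(1) by (simp add: field_simps)
  then have "(1 - \<kappa>) / (1 + \<delta>) = (1 - \<kappa>) * \<gamma> / 2" by simp
  moreover have "(1 - 2 * \<kappa> - 2 * \<tau>) * \<gamma> \<le> (1 - \<kappa>) * \<gamma>"
    using assms by (intro mult_right_mono) auto
  moreover have "(1 - 2 * \<kappa> - 2 * \<tau>) * \<gamma> \<le> (1 - 2 * \<kappa> - 2 * \<tau>) * 2"
    using assms False by (intro mult_left_mono) auto
  ultimately show ?thesis using assms by (simp add: min_def)
qed

text \<open>
  Used to make the truncation bias of the mean negligible against the signal.
\<close>

lemma eventually_exp_neg_powr_le_powr:
  fixes A B D e \<kappa> :: real
  assumes "0 < A" "0 < B" "0 < D" "0 < e" "\<kappa> \<le> 1"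
  shows "\<forall>\<^sub>F n :: nat in sequentially. exp (- (B * real n powr e)) * D \<le> A * real n powr - \<kappa>"
proof -
  have "\<forall>\<^sub>F n :: nat in sequentially. ln (D / A * real n) \<le> B * real n powr e"
    using assms by (intro eventually_ln_le_powr) auto
  then show ?thesis using eventually_ge_at_top[of 1]
  proof eventually_elim
    case (elim n)
    have "D / A * real n powr \<kappa> \<le> D / A * real n powr 1"
      using assms elim(2) by (intro mult_left_mono powr_mono) auto
    also have "\<dots> = exp (ln (D / A * real n))" using assms elim(2) by simp
    also have "\<dots> \<le> exp (B * real n powr e)" using elim(1) by simp
    finally show ?case
      using assms elim(2) by (simp add: exp_minus powr_minus field_simps)
  qed
qed

text \<open>
  With \<open>x = n\<close>, \<open>\<theta>\<close> is twice the multiplier for which the linear gain equals the threshold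
  \<open>c\<^sup>2 x powr (2 \<tau>)\<close>.  The truncation level \<open>m\<close> is of the largest order
  for which the quadratic loss has at most the order of the threshold, and the factor \<open>1/4\<close> makes the loss equal
  to the threshold, whatever the signal constant \<open>c\<close> is.  Hence the tail term at level \<open>m\<close> has a rate
  constant that does not involve \<open>c\<close>.
\<close>

lemma dual_multiplier_gain:
  fixes x c \<kappa> \<tau> :: real
  assumes x: "0 < x"
  defines "\<theta> \<equiv> 2 * c * x powr (\<kappa> + 2 * \<tau> - 1)"
    and "m \<equiv> x powr (1/2 - \<kappa> - \<tau>) / 4"
  shows "\<theta> * m = c / 2 * x powr (\<tau> - 1/2)"
    and "c\<^sup>2 * x powr (2 * \<tau>) = x * \<theta> * (c * x powr - \<kappa>) - 4 * x * (\<theta> * m)\<^sup>2"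
proof -
  have "\<theta> * m = c / 2 * (x powr (\<kappa> + 2 * \<tau> - 1) * x powr (1/2 - \<kappa> - \<tau>))"
    by (simp add: \<theta>_def m_def)
  also have "x powr (\<kappa> + 2 * \<tau> - 1) * x powr (1/2 - \<kappa> - \<tau>) = x powr (\<tau> - 1/2)"
    by (simp flip: powr_add)
  finally show \<theta>m: "\<theta> * m = c / 2 * x powr (\<tau> - 1/2)" .
  have "x * \<theta> * (c * x powr - \<kappa>) = 2 * c\<^sup>2 * (x powr 1 * x powr (\<kappa> + 2 * \<tau> - 1) * x powr - \<kappa>)"
    using x by (simp add: \<theta>_def power2_eq_square)
  also have "x powr 1 * x powr (\<kappa> + 2 * \<tau> - 1) * x powr - \<kappa> = x powr (2 * \<tau>)"
    by (simp only: powr_add[symmetric]) simp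
  finally have 1: "x * \<theta> * (c * x powr - \<kappa>) = 2 * c\<^sup>2 * x powr (2 * \<tau>)" .
  have "4 * x * (\<theta> * m)\<^sup>2 = c\<^sup>2 * (x powr 1 * (x powr (\<tau> - 1/2) * x powr (\<tau> - 1/2)))"
    using x by (simp add: \<theta>m power2_eq_square)
  also have "x powr 1 * (x powr (\<tau> - 1/2) * x powr (\<tau> - 1/2)) = x powr (2 * \<tau>)"
    by (simp only: powr_add[symmetric]) simp
  finally show "c\<^sup>2 * x powr (2 * \<tau>) = x * \<theta> * (c * x powr - \<kappa>) - 4 * x * (\<theta> * m)\<^sup>2"
    using 1 by simp
qed

section \<open>Sure screening\<close>

lemma (in prob_space) simultaneous_selection_prob:
  assumes J: "finite J"
    and meas: "\<And>j. j \<in> J \<Longrightarrow> {\<omega> \<in> space M. P j \<omega>} \<in> events"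
    and bad: "\<And>j. j \<in> J \<Longrightarrow> prob {\<omega> \<in> space M. \<not> P j \<omega>} \<le> q"
  shows "1 - real (card J) * q \<le> prob {\<omega> \<in> space M. \<forall>j\<in>J. P j \<omega>}"
proof -
  have meas': "{\<omega> \<in> space M. \<not> P j \<omega>} \<in> events" if "j \<in> J" for j
    using sets.sets_Collect_neg[OF meas[OF that]] .
  have "prob (\<Union>j\<in>J. {\<omega> \<in> space M. \<not> P j \<omega>}) \<le> (\<Sum>j\<in>J. prob {\<omega> \<in> space M. \<not> P j \<omega>})"
    using J meas' by (intro finite_measure_subadditive_finite) auto
  also have "\<dots> \<le> real (card J) * q"
    using bad by (rule sum_bounded_above)
  finally have "prob (\<Union>j\<in>J. {\<omega> \<in> space M. \<not> P j \<omega>}) \<le> real (card J) * q" .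
  moreover have "{\<omega> \<in> space M. \<forall>j\<in>J. P j \<omega>} = space M - (\<Union>j\<in>J. {\<omega> \<in> space M. \<not> P j \<omega>})"
    by auto
  moreover have "(\<Union>j\<in>J. {\<omega> \<in> space M. \<not> P j \<omega>}) \<in> events"
    using J meas' by auto
  ultimately show ?thesis by (simp add: prob_compl)
qed

theorem theorem2:
  fixes K1 K2 \<gamma>1 \<gamma>2 \<gamma> \<delta> :: real
  assumes "0 < K1" "0 < K2" "0 < \<gamma>1" "0 < \<gamma>2"
    and "\<gamma> = \<gamma>1 * \<gamma>2 / (\<gamma>1 + \<gamma>2)"
    and "\<delta> = max (2 / \<gamma> - 1) 0"
  shows "\<exists>C1>0. \<forall>c1>0. \<exists>C1'>0.
    \<forall>(M :: nat \<Rightarrow> 'a measure) (p :: nat \<Rightarrow> nat) (X :: nat \<Rightarrow> nat \<Rightarrow> 'a \<Rightarrow> real) (Y :: nat \<Rightarrow> 'a \<Rightarrow> real)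
      (\<beta> :: nat \<Rightarrow> nat \<Rightarrow> real) (Xs :: nat \<Rightarrow> nat \<Rightarrow> nat \<Rightarrow> 'a \<Rightarrow> real) (Ys :: nat \<Rightarrow> nat \<Rightarrow> 'a \<Rightarrow> real)
      (\<kappa> :: real) (\<tau> :: real) (C :: real).
      (\<forall>n\<ge>1. regression_setting (M n) n (p n) (X n) (Y n) (\<beta> n) (Xs n) (Ys n)) \<longrightarrow>
      assumption_A1 M p X Y \<beta> c1 \<kappa> \<longrightarrow>
      assumption_A2 M p X Y K1 K2 \<gamma>1 \<gamma>2 \<longrightarrow>
      0 < \<tau> \<longrightarrow> \<tau> < 1/2 - \<kappa> \<longrightarrow>
      C = (if (1 - 2 * \<kappa> - 2 * \<tau>) * \<gamma> / 2 < 1 - 2 * \<kappa> then C1 else C1') \<longrightarrow>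
      (\<forall>\<^sub>F n in sequentially.
        measure (M n) {\<omega> \<in> space (M n).
            active_set (p n) (\<beta> n) \<subseteq> selected_set n (p n) (Xs n) (Ys n) (c1\<^sup>2 * real n powr (2 * \<tau>)) \<omega>}
        \<ge> (if (1 - 2 * \<kappa>) * (1 + 2 * \<delta>) < 1
            then 1 - real (card (active_set (p n) (\<beta> n))) *
                   exp (- C * real n powr (min (1 - 2 * \<kappa>) ((1 - 2 * \<kappa> - 2 * \<tau>) * \<gamma> / 2)))
            else 1 - real (card (active_set (p n) (\<beta> n))) *
                   exp (- C * real n powr (min ((1 - \<kappa>) / (1 + \<delta>)) ((1 - 2 * \<kappa> - 2 * \<tau>) * \<gamma> / 2)))))"
proof -
  define h where "h = K2 / 2"
  have \<gamma>: "0 < \<gamma>" unfolding assms(5) using assms(3,4) by simp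
  have h: "0 < h" using assms(2) by (simp add: h_def)
  obtain D where D: "0 < D" and moment:
    "\<forall>(M :: 'a measure) Z. prob_space M \<longrightarrow> Z \<in> borel_measurable M \<longrightarrow>
      (\<forall>u>0. measure M {\<omega> \<in> space M. u \<le> \<bar>Z \<omega>\<bar>} \<le> 2 * K1 * exp (- K2 * u powr \<gamma>)) \<longrightarrow>
      integrable M (\<lambda>\<omega>. (Z \<omega>)\<^sup>2 * exp (h * (1 + \<bar>Z \<omega>\<bar> powr \<gamma>))) \<and>
      (\<integral>\<omega>. (Z \<omega>)\<^sup>2 * exp (h * (1 + \<bar>Z \<omega>\<bar> powr \<gamma>)) \<partial>M) \<le> D"
    using subweibull_weighted_moment[OF assms(1,2) \<gamma>, folded h_def] by (elim exE conjE) (rule that)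
  define C1 where "C1 = K2 / (2 * 4 powr \<gamma>)"
  have C1: "0 < C1" using assms by (simp add: C1_def)
  show ?thesis
  proof (rule exI[of _ C1], intro conjI allI impI C1)
    fix c1 :: real assume c1: "0 < c1"
    \<comment> \<open>The constant of the Chernoff parameter; its second bound keeps the quadratic remainder
      below an eighth of the signal.\<close>
    define \<epsilon> where "\<epsilon> = min h (c1 / (8 * D))"
    define c where "c = \<epsilon> * c1 / 4"
    have \<epsilon>: "0 < \<epsilon>" "\<epsilon> \<le> h" "\<epsilon> * D \<le> c1 / 8"
      using h c1 D by (auto simp: \<epsilon>_def min_def field_simps)
    have c: "0 < c" using \<epsilon> c1 by (simp add: c_def)
    define C1' where "C1' = min C1 (c / 2)"
    have C1': "0 < C1'" using C1 c by (simp add: C1'_def)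
    show "\<exists>C1'>0. \<forall>(M :: nat \<Rightarrow> 'a measure) p X Y \<beta> Xs Ys \<kappa> \<tau> C.
      (\<forall>n\<ge>1. regression_setting (M n) n (p n) (X n) (Y n) (\<beta> n) (Xs n) (Ys n)) \<longrightarrow>
      assumption_A1 M p X Y \<beta> c1 \<kappa> \<longrightarrow>
      assumption_A2 M p X Y K1 K2 \<gamma>1 \<gamma>2 \<longrightarrow>
      0 < \<tau> \<longrightarrow> \<tau> < 1/2 - \<kappa> \<longrightarrow>
      C = (if (1 - 2 * \<kappa> - 2 * \<tau>) * \<gamma> / 2 < 1 - 2 * \<kappa> then C1 else C1') \<longrightarrow>
      (\<forall>\<^sub>F n in sequentially.
        (if (1 - 2 * \<kappa>) * (1 + 2 * \<delta>) < 1
            then 1 - real (card (active_set (p n) (\<beta> n))) *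
                   exp (- C * real n powr (min (1 - 2 * \<kappa>) ((1 - 2 * \<kappa> - 2 * \<tau>) * \<gamma> / 2)))
            else 1 - real (card (active_set (p n) (\<beta> n))) *
                   exp (- C * real n powr (min ((1 - \<kappa>) / (1 + \<delta>)) ((1 - 2 * \<kappa> - 2 * \<tau>) * \<gamma> / 2))))
        \<le> measure (M n) {\<omega> \<in> space (M n).
            active_set (p n) (\<beta> n) \<subseteq> selected_set n (p n) (Xs n) (Ys n) (c1\<^sup>2 * real n powr (2 * \<tau>)) \<omega>})"
    proof (rule exI[of _ C1'], intro conjI allI impI C1')
      fix M :: "nat \<Rightarrow> 'a measure" and p :: "nat \<Rightarrow> nat" and X Y \<beta> Xs Ys and \<kappa> \<tau> C :: real
      assume setting: "\<forall>n\<ge>1. regression_setting (M n) n (p n) (X n) (Y n) (\<beta> n) (Xs n) (Ys n)"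
        and A1: "assumption_A1 M p X Y \<beta> c1 \<kappa>" and A2: "assumption_A2 M p X Y K1 K2 \<gamma>1 \<gamma>2"
        and \<tau>: "0 < \<tau>" "\<tau> < 1/2 - \<kappa>"
        and C: "C = (if (1 - 2 * \<kappa> - 2 * \<tau>) * \<gamma> / 2 < 1 - 2 * \<kappa> then C1 else C1')"
      have \<kappa>: "0 \<le> \<kappa>" "\<kappa> < 1/2" using A1 by (auto simp: assumption_A1_def)
      define a where "a = 1/2 - \<kappa> - \<tau>"
      define s where "s = max \<kappa> (a * (1 - \<gamma>))"
      define \<rho> where "\<rho> = 1 - \<kappa> - s"
      define r where "r = min (1 - 2 * \<kappa>) ((1 - 2 * \<kappa> - 2 * \<tau>) * \<gamma> / 2)"
      have a: "0 < a" using \<tau> by (simp add: a_def)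
      have a\<gamma>: "(1 - 2 * \<kappa> - 2 * \<tau>) * \<gamma> / 2 = a * \<gamma>" by (simp add: a_def field_simps)
      have a\<gamma>_pos: "0 < a * \<gamma>" using a \<gamma> by simp
      have \<rho>_eq: "\<rho> = min (1 - 2 * \<kappa>) (1/2 + \<tau> + a * \<gamma>)"
      proof -
        have "a * (1 - \<gamma>) = a - a * \<gamma>" by (simp add: algebra_simps)
        moreover have "a = 1/2 - \<kappa> - \<tau>" by (rule a_def)
        ultimately show ?thesis unfolding \<rho>_def s_def by linarith
      qed
      \<comment> \<open>Equality of the exponents happens only at \<open>r = 1 - 2 \<kappa> \<le> a \<gamma>\<close>, the case in which \<open>C = C1'\<close>.\<close>
      have \<rho>: "0 < \<rho>" "r < \<rho> \<or> r = \<rho> \<and> C < c"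
        using a\<gamma>_pos \<tau> \<kappa> c by (auto simp: \<rho>_eq r_def a\<gamma> C C1'_def min_def)
      have Cle: "0 < C" "C \<le> K2 / (2 * 4 powr \<gamma>)"
        using C1 C1' by (auto simp: C C1'_def C1_def[symmetric])
      have rate: "\<forall>\<^sub>F n :: nat in sequentially.
          real n * (2 * K1 * exp (- K2 * (real n powr a / 4) powr \<gamma>)) + exp (- (c * real n powr \<rho>))
            \<le> exp (- C * real n powr r)"
        using assms(1,2) \<gamma> a c \<rho> Cle by (intro eventually_error_le_rate) (auto simp: r_def a\<gamma>)
      have trunc: "\<forall>\<^sub>F n :: nat in sequentially. 1 \<le> 1/4 * real n powr a"
        using a by (intro eventually_const_le_powr) auto
      have tail_mean: "\<forall>\<^sub>F n :: nat in sequentially.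
          exp (- (h / 4 powr \<gamma> * real n powr (a * \<gamma>))) * D \<le> c1 / 8 * real n powr - \<kappa>"
        using c1 h D a\<gamma>_pos \<kappa> by (intro eventually_exp_neg_powr_le_powr) auto
      have dual: "\<forall>\<^sub>F n :: nat in sequentially. c1 \<le> 1 * real n powr (1/2 - \<tau>)"
        using \<tau> \<kappa> by (intro eventually_const_le_powr) auto
      show "\<forall>\<^sub>F n in sequentially.
        (if (1 - 2 * \<kappa>) * (1 + 2 * \<delta>) < 1
            then 1 - real (card (active_set (p n) (\<beta> n))) *
                   exp (- C * real n powr (min (1 - 2 * \<kappa>) ((1 - 2 * \<kappa> - 2 * \<tau>) * \<gamma> / 2)))
            else 1 - real (card (active_set (p n) (\<beta> n))) *
                   exp (- C * real n powr (min ((1 - \<kappa>) / (1 + \<delta>)) ((1 - 2 * \<kappa> - 2 * \<tau>) * \<gamma> / 2))))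
        \<le> measure (M n) {\<omega> \<in> space (M n).
            active_set (p n) (\<beta> n) \<subseteq> selected_set n (p n) (Xs n) (Ys n) (c1\<^sup>2 * real n powr (2 * \<tau>)) \<omega>}"
        using rate trunc tail_mean dual eventually_ge_at_top[of 1]
      proof eventually_elim
        case (elim n)
        then have n: "1 \<le> n" by simp
        have reg: "prob_space (M n)" "observation (p n) (X n) (Y n) \<in> M n \<rightarrow>\<^sub>M observation_space (p n)"
            "iid_copies (M n) n (p n) (X n) (Y n) (Xs n) (Ys n)"
          using setting n by (auto simp: regression_setting_def)
        interpret prob_space "M n" by (rule reg(1))
        let ?J = "active_set (p n) (\<beta> n)" and ?T = "c1\<^sup>2 * real n powr (2 * \<tau>)"
        let ?W = "\<lambda>j i \<omega>. Xs n i j \<omega> * Ys n i \<omega>"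
        have J: "?J \<subseteq> {1..p n}" "finite ?J" by (auto simp: active_set_def)
        define m where "m = real n powr a / 4"
        define t where "t = \<epsilon> * real n powr - s"
        define b where "b = c1 * real n powr - \<kappa>"
        define \<theta> where "\<theta> = 2 * c1 * real n powr (\<kappa> + 2 * \<tau> - 1)"
        have \<theta>m: "\<theta> * m = c1 / 2 * real n powr (\<tau> - 1/2)"
          and gain: "?T = real n * \<theta> * b - 4 * real n * (\<theta> * m)\<^sup>2"
          using dual_multiplier_gain[where x = "real n" and c = c1 and \<kappa> = \<kappa> and \<tau> = \<tau>,
              folded a_def, folded \<theta>_def m_def b_def] n by simp_all
        have meas: "{\<omega> \<in> space (M n). ereal ?T \<le> EL_ratio n (\<lambda>i. ?W j i \<omega>)} \<in> events" if "j \<in> ?J" for j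
        proof (rule measurable_EL_ratio_ge[OF n])
          show "?W j i \<in> borel_measurable (M n)" if "i \<in> {1..n}" for i
            using iid_copies_product(1)[OF reg, of j] J(1) \<open>j \<in> ?J\<close> that by (auto simp: indep_vars_def)
        qed
        have bad: "prob {\<omega> \<in> space (M n). \<not> ereal ?T \<le> EL_ratio n (\<lambda>i. ?W j i \<omega>)} \<le> exp (- C * real n powr r)"
          if "j \<in> ?J" for j
        proof -
          have j: "j \<in> {1..p n}" using that J(1) by blast
          define Z where "Z \<omega> = X n j \<omega> * Y n \<omega>" for \<omega>
          have XY: "X n j \<in> borel_measurable (M n)" "Y n \<in> borel_measurable (M n)"
            using observation_components_measurable[OF reg(2)] j by auto
          then have Z: "Z \<in> borel_measurable (M n)" unfolding Z_def by simp
          have tail: "prob {\<omega> \<in> space (M n). u \<le> \<bar>Z \<omega>\<bar>} \<le> 2 * K1 * exp (- K2 * u powr \<gamma>)" if "0 < u" for u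
            unfolding Z_def assms(5)
            using A2 n j XY that by (intro subweibull_product) (auto simp: assumption_A2_def)
          have "prob {\<omega> \<in> space (M n). \<not> ereal ?T \<le> EL_ratio n (\<lambda>i. ?W j i \<omega>)} \<le>
              real n * (2 * K1 * exp (- K2 * m powr \<gamma>)) + exp (- (t * b * real n / 4))"
          proof (rule nonselection_bound[OF n _ Z, where \<theta> = \<theta> and h = h and \<gamma> = \<gamma> and D = D])
            show "indep_vars (\<lambda>_. borel) (?W j) {1..n}"
              by (rule iid_copies_product(1)[OF reg j])
            show "distr (M n) borel (?W j i) = distr (M n) borel Z" if "i \<in> {1..n}" for i
              unfolding Z_def using iid_copies_product(2)[OF reg j that] .
            show "integrable (M n) (\<lambda>\<omega>. (Z \<omega>)\<^sup>2 * exp (h * (1 + \<bar>Z \<omega>\<bar> powr \<gamma>)))"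
                "expectation (\<lambda>\<omega>. (Z \<omega>)\<^sup>2 * exp (h * (1 + \<bar>Z \<omega>\<bar> powr \<gamma>))) \<le> D"
              using moment[rule_format, OF reg(1) Z tail] by simp_all
            show m: "1 \<le> m" using elim(2) by (simp add: m_def)
            then show "prob {\<omega> \<in> space (M n). m \<le> \<bar>Z \<omega>\<bar>} \<le> 2 * K1 * exp (- K2 * m powr \<gamma>)"
              by (intro tail) simp
            show "b \<le> \<bar>expectation Z\<bar>"
              using A1 n that by (auto simp: assumption_A1_def b_def Z_def[abs_def])
            show "t * \<bar>z\<bar> \<le> h * (1 + \<bar>z\<bar> powr \<gamma>)" if "\<bar>z\<bar> \<le> m" for z
            proof -
              have "m \<le> real n powr a" by (simp add: m_def)
              with that show ?thesis
                unfolding t_def s_def using \<epsilon> \<gamma> a \<kappa> n by (intro linear_le_subweibull_exponent) auto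
            qed
            have "t * D \<le> c1 / 8 * real n powr - s"
              using mult_right_mono[OF \<epsilon>(3), of "real n powr - s"] by (simp add: t_def mult_ac)
            also have "\<dots> \<le> c1 / 8 * real n powr - \<kappa>"
              using c1 n by (intro mult_left_mono powr_mono) (auto simp: s_def)
            finally show "t * D \<le> b / 8" by (simp add: b_def)
            have "h * m powr \<gamma> = h / 4 powr \<gamma> * real n powr (a * \<gamma>)"
              by (simp add: m_def powr_divide powr_powr)
            then show "exp (- h * m powr \<gamma>) * D \<le> b / 8"
              using elim(3) by (simp add: b_def)
            have "c1 * real n powr (\<tau> - 1/2) \<le> real n powr (1/2 - \<tau>) * real n powr (\<tau> - 1/2)"
              using elim(4) by (intro mult_right_mono) auto
            also have "\<dots> = 1" using n by (simp flip: powr_add)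
            finally show "\<theta> * m \<le> 1/2" by (simp add: \<theta>m)
            show "?T \<le> real n * \<theta> * b - 4 * real n * (\<theta> * m)\<^sup>2" using gain by simp
          qed (use h \<gamma> \<epsilon> c1 in \<open>auto simp: b_def t_def \<theta>_def\<close>)
          also have "t * b * real n / 4 = c * real n powr \<rho>"
          proof -
            have "real n powr - s * real n powr - \<kappa> * real n powr 1 = real n powr \<rho>"
              by (simp only: powr_add[symmetric]) (simp add: \<rho>_def algebra_simps)
            then show ?thesis using n by (simp add: t_def b_def c_def mult_ac)
          qed
          also have "real n * (2 * K1 * exp (- K2 * m powr \<gamma>)) + exp (- (c * real n powr \<rho>)) \<le>
              exp (- C * real n powr r)"
            using elim(1) by (simp add: m_def)
          finally show ?thesis .
        qed
        have "1 - real (card ?J) * exp (- C * real n powr r) \<le>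
            prob {\<omega> \<in> space (M n). \<forall>j\<in>?J. ereal ?T \<le> EL_ratio n (\<lambda>i. ?W j i \<omega>)}"
          using J(2) meas bad by (rule simultaneous_selection_prob)
        also have "{\<omega> \<in> space (M n). \<forall>j\<in>?J. ereal ?T \<le> EL_ratio n (\<lambda>i. ?W j i \<omega>)} =
            {\<omega> \<in> space (M n). ?J \<subseteq> selected_set n (p n) (Xs n) (Ys n) ?T \<omega>}"
          using J(1) by (auto simp: selected_set_def)
        finally show ?case
          using screening_exponent_eq[OF \<gamma> assms(6) \<kappa> \<tau>] by (simp add: r_def not_less)
      qed
    qed
  qed
qed

end
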